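(* Let $T$ be a complete stable theory. Then for every cardinal $\kappa\ge|T|$, $T$ has local PC-exact saturation at $\kappa$.
   Context: Local saturation: for finite $\Delta$, a $\Delta$-type over $A$ is a maximal consistent set of formulas $\psi(x,a)$ ($x$ finite, $a$ from $A$) with $\psi$ a variable substitution of a formula in the Boolean algebra generated by $\Delta$; $M$ is $\lambda$-locally saturated if all such types over sets $A\subseteq M$ with $|A|<\lambda$ are realized in $M$. For $T_1\supseteq T$ (in $L_1\supseteq L$), $PC(T_1,T)$ is the class of models of $T$ having an expansion to a model of $T_1$; it has local exact saturation at $\kappa$ if some member is $\kappa$-locally saturated but not $\kappa^+$-locally saturated. $T$ has local PC-exact saturation at $\kappa$ if $PC(T_1,T)$ has local exact saturation at $\kappa$ for every $T_1\supseteq T$ with $|T_1|=|T|$.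
   Formalization: T is additionally assumed to have infinite models, and each T_1 to be consistent; the claim fails for complete theories of finite structures (all their local types are realized) and for inconsistent T_1 (PC(T_1,T) is empty). *)

theory Defs
  imports Main
begin

unbundle cardinal_syntax

section \<open>First-order logic with equality\<close>

text \<open>
  Variables are de Bruijn indices: inside \<open>Ex \<phi>\<close> the index \<open>0\<close> is the bound variable and
  \<open>Suc i\<close> is the variable \<open>i\<close> outside. A language is given by its symbols together with
  their arities; a symbol listed with two arities counts as two different symbols.
\<close>

datatype 'f tm = Var nat | Fun 'f "'f tm list"

datatype ('f, 'r) fm =
    Bot
  | Eq "'f tm" "'f tm"
  | Rel 'r "'f tm list"
  | Neg "('f, 'r) fm"
  | And "('f, 'r) fm" "('f, 'r) fm"
  | Ex "('f, 'r) fm"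

record ('f, 'r) language =
  funs :: "('f \<times> nat) set"
  rels :: "('r \<times> nat) set"

definition sublanguage :: "('f, 'r) language \<Rightarrow> ('f, 'r) language \<Rightarrow> bool" where
  "sublanguage L L1 \<longleftrightarrow> funs L \<subseteq> funs L1 \<and> rels L \<subseteq> rels L1"

fun tm_in :: "('f, 'r) language \<Rightarrow> 'f tm \<Rightarrow> bool" where
  "tm_in L (Var i) \<longleftrightarrow> True"
| "tm_in L (Fun f ts) \<longleftrightarrow> (f, length ts) \<in> funs L \<and> (\<forall>t\<in>set ts. tm_in L t)"

fun fm_in :: "('f, 'r) language \<Rightarrow> ('f, 'r) fm \<Rightarrow> bool" where
  "fm_in L Bot \<longleftrightarrow> True"
| "fm_in L (Eq s t) \<longleftrightarrow> tm_in L s \<and> tm_in L t"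
| "fm_in L (Rel r ts) \<longleftrightarrow> (r, length ts) \<in> rels L \<and> (\<forall>t\<in>set ts. tm_in L t)"
| "fm_in L (Neg \<phi>) \<longleftrightarrow> fm_in L \<phi>"
| "fm_in L (And \<phi> \<psi>) \<longleftrightarrow> fm_in L \<phi> \<and> fm_in L \<psi>"
| "fm_in L (Ex \<phi>) \<longleftrightarrow> fm_in L \<phi>"

definition formulas :: "('f, 'r) language \<Rightarrow> ('f, 'r) fm set" where
  "formulas L = {\<phi>. fm_in L \<phi>}"

fun fv_tm :: "'f tm \<Rightarrow> nat set" where
  "fv_tm (Var i) = {i}"
| "fv_tm (Fun f ts) = (\<Union>t\<in>set ts. fv_tm t)"

fun fv :: "('f, 'r) fm \<Rightarrow> nat set" where
  "fv Bot = {}"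
| "fv (Eq s t) = fv_tm s \<union> fv_tm t"
| "fv (Rel r ts) = (\<Union>t\<in>set ts. fv_tm t)"
| "fv (Neg \<phi>) = fv \<phi>"
| "fv (And \<phi> \<psi>) = fv \<phi> \<union> fv \<psi>"
| "fv (Ex \<phi>) = {i. Suc i \<in> fv \<phi>}"

definition sentences :: "('f, 'r) language \<Rightarrow> ('f, 'r) fm set" where
  "sentences L = {\<phi> \<in> formulas L. fv \<phi> = {}}"

text \<open>Capture-free substitution of variables for variables; distinct variables may be identified.\<close>

fun rename_tm :: "(nat \<Rightarrow> nat) \<Rightarrow> 'f tm \<Rightarrow> 'f tm" where
  "rename_tm \<sigma> (Var i) = Var (\<sigma> i)"
| "rename_tm \<sigma> (Fun f ts) = Fun f (map (rename_tm \<sigma>) ts)"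

fun rename :: "(nat \<Rightarrow> nat) \<Rightarrow> ('f, 'r) fm \<Rightarrow> ('f, 'r) fm" where
  "rename \<sigma> Bot = Bot"
| "rename \<sigma> (Eq s t) = Eq (rename_tm \<sigma> s) (rename_tm \<sigma> t)"
| "rename \<sigma> (Rel r ts) = Rel r (map (rename_tm \<sigma>) ts)"
| "rename \<sigma> (Neg \<phi>) = Neg (rename \<sigma> \<phi>)"
| "rename \<sigma> (And \<phi> \<psi>) = And (rename \<sigma> \<phi>) (rename \<sigma> \<psi>)"
| "rename \<sigma> (Ex \<phi>) = Ex (rename (case_nat 0 (\<lambda>i. Suc (\<sigma> i))) \<phi>)"

section \<open>Structures\<close>

text \<open>
  Only the values of \<open>func\<close> and \<open>rel\<close> at symbols of the language, on tuples of the right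
  length from the carrier, are meaningful. So a structure for a language is also a structure
  for each sublanguage, and there it plays the role of its own reduct.
\<close>

record ('f, 'r, 'u) struct =
  carrier :: "'u set"
  func :: "'f \<Rightarrow> 'u list \<Rightarrow> 'u"
  rel :: "'r \<Rightarrow> 'u list \<Rightarrow> bool"

definition tuples :: "nat \<Rightarrow> 'u set \<Rightarrow> 'u list set" where
  "tuples n A = {xs. length xs = n \<and> set xs \<subseteq> A}"

definition is_struct :: "('f, 'r) language \<Rightarrow> ('f, 'r, 'u) struct \<Rightarrow> bool" where
  "is_struct L M \<longleftrightarrow> carrier M \<noteq> {} \<and>
     (\<forall>(f, n)\<in>funs L. \<forall>xs\<in>tuples n (carrier M). func M f xs \<in> carrier M)"

fun val :: "('f, 'r, 'u) struct \<Rightarrow> (nat \<Rightarrow> 'u) \<Rightarrow> 'f tm \<Rightarrow> 'u" where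
  "val M e (Var i) = e i"
| "val M e (Fun f ts) = func M f (map (val M e) ts)"

fun sat :: "('f, 'r, 'u) struct \<Rightarrow> (nat \<Rightarrow> 'u) \<Rightarrow> ('f, 'r) fm \<Rightarrow> bool" where
  "sat M e Bot \<longleftrightarrow> False"
| "sat M e (Eq s t) \<longleftrightarrow> val M e s = val M e t"
| "sat M e (Rel r ts) \<longleftrightarrow> rel M r (map (val M e) ts)"
| "sat M e (Neg \<phi>) \<longleftrightarrow> \<not> sat M e \<phi>"
| "sat M e (And \<phi> \<psi>) \<longleftrightarrow> sat M e \<phi> \<and> sat M e \<psi>"
| "sat M e (Ex \<phi>) \<longleftrightarrow> (\<exists>a\<in>carrier M. sat M (case_nat a e) \<phi>)"

text \<open>Truth of a formula with free variables below \<open>length xs\<close> at the tuple \<open>xs\<close>.\<close>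

definition sat_at :: "('f, 'r, 'u) struct \<Rightarrow> ('f, 'r) fm \<Rightarrow> 'u list \<Rightarrow> bool" where
  "sat_at M \<phi> xs \<longleftrightarrow> sat M (\<lambda>i. xs ! i) \<phi>"

definition is_expansion ::
    "('f, 'r) language \<Rightarrow> ('f, 'r, 'u) struct \<Rightarrow> ('f, 'r, 'u) struct \<Rightarrow> bool" where
  "is_expansion L M N \<longleftrightarrow> carrier N = carrier M \<and>
     (\<forall>(f, n)\<in>funs L. \<forall>xs\<in>tuples n (carrier M). func N f xs = func M f xs) \<and>
     (\<forall>(r, n)\<in>rels L. \<forall>xs\<in>tuples n (carrier M). rel N r xs = rel M r xs)"

section \<open>Theories\<close>

text \<open>
  A theory is a set of sentences of a language. Its models are collected with carriers inside
  the type \<open>'u\<close>. By the downward Loewenheim-Skolem theorem, for a theory whose language has at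
  most \<open>\<kappa>\<close> formulas, and \<open>'u\<close> with at least \<open>2 ^ \<kappa>\<close> elements, every notion below that
  quantifies over models has the same meaning as with models of arbitrary size: a model of a
  theory, a counterexample to a consequence, and an instance of the order property can be cut
  down to size at most \<open>\<kappa>\<close>. A \<open>\<kappa>\<close>-locally saturated member of a pseudo-elementary
  class that omits a local type over at most \<open>\<kappa>\<close> parameters can be cut down to such a
  member of size at most \<open>2 ^ \<kappa>\<close>, by closing these parameters under Skolem functions and
  under realizations of local types over sets of size less than \<open>\<kappa>\<close>.
\<close>

definition Mod :: "('f, 'r) language \<Rightarrow> ('f, 'r) fm set \<Rightarrow> ('f, 'r, 'u) struct set" where
  "Mod L T = {M. is_struct L M \<and> (\<forall>\<phi>\<in>T. sat_at M \<phi> [])}"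

definition is_theory :: "'u itself \<Rightarrow> ('f, 'r) language \<Rightarrow> ('f, 'r) fm set \<Rightarrow> bool" where
  "is_theory U L T \<longleftrightarrow> T \<subseteq> sentences L \<and> (Mod L T :: ('f, 'r, 'u) struct set) \<noteq> {}"

definition complete_theory :: "'u itself \<Rightarrow> ('f, 'r) language \<Rightarrow> ('f, 'r) fm set \<Rightarrow> bool" where
  "complete_theory U L T \<longleftrightarrow> is_theory U L T \<and>
     (\<forall>\<phi>\<in>sentences L.
        (\<forall>M\<in>(Mod L T :: ('f, 'r, 'u) struct set). sat_at M \<phi> []) \<or>
        (\<forall>M\<in>(Mod L T :: ('f, 'r, 'u) struct set). sat_at M (Neg \<phi>) []))"

text \<open>
  \<open>M\<close> contains tuples \<open>a i\<close> of length \<open>m\<close> and \<open>b j\<close> of length \<open>k\<close> with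
  \<open>\<phi>(a i, b j)\<close> true exactly when \<open>i < j\<close>.
\<close>

definition order_property_in ::
    "('f, 'r, 'u) struct \<Rightarrow> ('f, 'r) fm \<Rightarrow> nat \<Rightarrow> nat \<Rightarrow> bool" where
  "order_property_in M \<phi> m k \<longleftrightarrow>
     (\<exists>a b :: nat \<Rightarrow> 'u list.
        (\<forall>i. a i \<in> tuples m (carrier M)) \<and> (\<forall>j. b j \<in> tuples k (carrier M)) \<and>
        (\<forall>i j. sat_at M \<phi> (a i @ b j) \<longleftrightarrow> i < j))"

definition stable_theory :: "'u itself \<Rightarrow> ('f, 'r) language \<Rightarrow> ('f, 'r) fm set \<Rightarrow> bool" where
  "stable_theory U L T \<longleftrightarrow>
     (\<nexists>\<phi> m k (M :: ('f, 'r, 'u) struct).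
        \<phi> \<in> formulas L \<and> fv \<phi> \<subseteq> {..<m + k} \<and> M \<in> Mod L T \<and> order_property_in M \<phi> m k)"

text \<open>
  The cardinality of a theory is, as usual, the number of formulas of its language,
  that is, the number of symbols plus \<open>\<aleph>\<^sub>0\<close>.
\<close>

definition theory_card :: "('f, 'r) language \<Rightarrow> ('f, 'r) fm rel" where
  "theory_card L = |formulas L|"

section \<open>Local types and local saturation\<close>

inductive_set bool_alg :: "('f, 'r) fm set \<Rightarrow> ('f, 'r) fm set" for \<Delta> where
  gen: "\<phi> \<in> \<Delta> \<Longrightarrow> \<phi> \<in> bool_alg \<Delta>"
| bot: "Bot \<in> bool_alg \<Delta>"
| neg: "\<phi> \<in> bool_alg \<Delta> \<Longrightarrow> Neg \<phi> \<in> bool_alg \<Delta>"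
| conj: "\<phi> \<in> bool_alg \<Delta> \<Longrightarrow> \<psi> \<in> bool_alg \<Delta> \<Longrightarrow> And \<phi> \<psi> \<in> bool_alg \<Delta>"

text \<open>
  The pair \<open>(\<psi>, as)\<close> stands for the formula \<open>\<psi>(x, as)\<close> with parameters \<open>as\<close>: the variables
  \<open>0, \<dots>, n - 1\<close> of \<open>\<psi>\<close> are the tuple \<open>x\<close>, and the variable \<open>n + i\<close> is
  replaced by \<open>as ! i\<close>.
\<close>

definition instances ::
    "('f, 'r) fm set \<Rightarrow> nat \<Rightarrow> 'u set \<Rightarrow> (('f, 'r) fm \<times> 'u list) set" where
  "instances \<Delta> n A =
     {(\<psi>, as). (\<exists>\<theta>\<in>bool_alg \<Delta>. \<exists>\<sigma>. \<psi> = rename \<sigma> \<theta>) \<and>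
        set as \<subseteq> A \<and> fv \<psi> \<subseteq> {..<n + length as}}"

definition realizes ::
    "('f, 'r, 'u) struct \<Rightarrow> nat \<Rightarrow> 'u list \<Rightarrow> (('f, 'r) fm \<times> 'u list) set \<Rightarrow> bool" where
  "realizes M n c p \<longleftrightarrow> c \<in> tuples n (carrier M) \<and> (\<forall>(\<psi>, as)\<in>p. sat_at M \<psi> (c @ as))"

text \<open>
  Consistency of a set of formulas over parameters from \<open>M\<close> (that is, consistency with the
  elementary diagram of \<open>M\<close>) is finite satisfiability in \<open>M\<close>.
\<close>

definition consistent_in ::
    "('f, 'r, 'u) struct \<Rightarrow> nat \<Rightarrow> (('f, 'r) fm \<times> 'u list) set \<Rightarrow> bool" where
  "consistent_in M n p \<longleftrightarrow> (\<forall>q. finite q \<and> q \<subseteq> p \<longrightarrow> (\<exists>c. realizes M n c q))"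

definition is_local_type ::
    "('f, 'r, 'u) struct \<Rightarrow> ('f, 'r) fm set \<Rightarrow> nat \<Rightarrow> 'u set \<Rightarrow>
     (('f, 'r) fm \<times> 'u list) set \<Rightarrow> bool" where
  "is_local_type M \<Delta> n A p \<longleftrightarrow> p \<subseteq> instances \<Delta> n A \<and> consistent_in M n p \<and>
     (\<forall>q. p \<subseteq> q \<and> q \<subseteq> instances \<Delta> n A \<and> consistent_in M n q \<longrightarrow> q = p)"

definition locally_saturated ::
    "('f, 'r) language \<Rightarrow> ('f, 'r, 'u) struct \<Rightarrow> 'k rel \<Rightarrow> bool" where
  "locally_saturated L M \<mu> \<longleftrightarrow>
     (\<forall>\<Delta> n A p. finite \<Delta> \<and> \<Delta> \<subseteq> formulas L \<and> A \<subseteq> carrier M \<and> |A| <o \<mu> \<and>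
        is_local_type M \<Delta> n A p \<longrightarrow> (\<exists>c. realizes M n c p))"

section \<open>Pseudo-elementary classes\<close>

definition PC ::
    "('f, 'r) language \<Rightarrow> ('f, 'r) fm set \<Rightarrow> ('f, 'r) language \<Rightarrow> ('f, 'r) fm set \<Rightarrow>
     ('f, 'r, 'u) struct set" where
  "PC L1 T1 L T = {M \<in> Mod L T. \<exists>N\<in>Mod L1 T1. is_expansion L M N}"

definition local_exact_saturation ::
    "('f, 'r) language \<Rightarrow> ('f, 'r, 'u) struct set \<Rightarrow> 'k rel \<Rightarrow> bool" where
  "local_exact_saturation L C \<kappa> \<longleftrightarrow>
     (\<exists>M\<in>C. locally_saturated L M \<kappa> \<and> \<not> locally_saturated L M (cardSuc \<kappa>))"

text \<open>
  The symbols of \<open>L1\<close> are drawn from the same types \<open>'f\<close> and \<open>'r\<close> as those of \<open>L\<close>. These are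
  type variables and \<open>L\<close> need not exhaust them, so a statement for all \<open>'f\<close> and \<open>'r\<close> covers
  all languages extending \<open>L\<close>.
\<close>

definition local_PC_exact_saturation ::
    "'u itself \<Rightarrow> ('f, 'r) language \<Rightarrow> ('f, 'r) fm set \<Rightarrow> 'k rel \<Rightarrow> bool" where
  "local_PC_exact_saturation U L T \<kappa> \<longleftrightarrow>
     (\<forall>L1 T1. sublanguage L L1 \<and> T \<subseteq> T1 \<and> is_theory U L1 T1 \<and>
        theory_card L1 =o theory_card L \<longrightarrow>
        local_exact_saturation L (PC L1 T1 L T :: ('f, 'r, 'u) struct set) \<kappa>)"

end

theory Submission
  imports Defs
begin

text \<open>
  Let \<open>N\<close> be a model of \<open>T1\<close>. The required model \<open>M\<close> has size at most \<open>\<kappa>\<close>, so it omits the type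
  of an element different from all elements of \<open>M\<close> and is not locally saturated at the
  successor of \<open>\<kappa>\<close>. It is \<open>\<kappa>\<close>-locally saturated for the following reason.

  A type that is finitely satisfiable in \<open>M\<close> extends to an ultrafilter \<open>D\<close> on tuples of \<open>M\<close>. Since
  half graphs of formulas of \<open>L\<close> have bounded length, for some \<open>k\<close> there are, for every \<open>m\<close>,
  sequences of \<open>m\<close> tuples from which each local formula over \<open>M\<close> receives its \<open>D\<close>-value at all
  but fewer than \<open>k\<close> places. In particular \<open>D\<close>-values are majority votes on \<open>2 * k\<close> tuples \<open>e\<close>.
  If \<open>M\<close> contains with \<open>e\<close> also such a sequence of length \<open>\<kappa>\<close>, then fewer than \<open>\<kappa>\<close> parameters
  spoil only fewer than \<open>\<kappa>\<close> of its members, and the others realize the type; regularity of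
  \<open>\<kappa>\<close> plays no role.

  To have long sequences for all \<open>e\<close> at once, \<open>M\<close> is taken as a substructure of size \<open>\<kappa>\<close> of an
  ultrapower of \<open>N\<close> over an iterated tensor power of an ultrafilter on the finite subsets of
  \<open>\<kappa>\<close>. An element depends on finitely many coordinates only, and a sequence of finite
  approximations can be read off at the next coordinate, which is small compared with
  everything defined before.
\<close>

section \<open>Ultrafilters\<close>

definition ae :: "'a set set \<Rightarrow> ('a \<Rightarrow> bool) \<Rightarrow> bool" where
  "ae U P \<longleftrightarrow> {x. P x} \<in> U"

text \<open>An ultrafilter is encoded as a Boolean homomorphism to the truth values, so that
  \<open>ae U\<close> commutes with all connectives; properness and upward closure follow in
  \<open>ultra_const\<close> and \<open>ultra_mono\<close>.\<close>

definition ultra :: "'a set set \<Rightarrow> bool" where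
  "ultra U \<longleftrightarrow> (\<forall>X. - X \<in> U \<longleftrightarrow> X \<notin> U) \<and> (\<forall>X Y. X \<inter> Y \<in> U \<longleftrightarrow> X \<in> U \<and> Y \<in> U)"

lemma ultra_not: "ultra U \<Longrightarrow> ae U (\<lambda>x. \<not> P x) \<longleftrightarrow> \<not> ae U P"
  unfolding ultra_def ae_def by (simp add: Collect_neg_eq)

lemma ultra_conj: "ultra U \<Longrightarrow> ae U (\<lambda>x. P x \<and> Q x) \<longleftrightarrow> ae U P \<and> ae U Q"
  unfolding ultra_def ae_def by (simp add: Collect_conj_eq)

lemma ultra_iff:
  "(\<And>P. ae U (\<lambda>x. \<not> P x) \<longleftrightarrow> \<not> ae U P) \<Longrightarrow>
   (\<And>P Q. ae U (\<lambda>x. P x \<and> Q x) \<longleftrightarrow> ae U P \<and> ae U Q) \<Longrightarrow> ultra U"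
  unfolding ultra_def ae_def by (metis Collect_conj_eq Collect_mem_eq Collect_neg_eq)

lemma ultra_const:
  assumes "ultra U"
  shows "ae U (\<lambda>x. c) \<longleftrightarrow> c"
proof -
  have "\<not> ae U (\<lambda>x. False)"
    using ultra_conj[OF assms, of "\<lambda>x. True" "\<lambda>x. False"] ultra_not[OF assms, of "\<lambda>x. True"] by simp
  thus ?thesis using ultra_not[OF assms, of "\<lambda>x. False"] by (cases c) simp_all
qed

lemma ultra_mono: "ultra U \<Longrightarrow> ae U P \<Longrightarrow> (\<And>x. P x \<Longrightarrow> Q x) \<Longrightarrow> ae U Q"
proof -
  assume U: "ultra U" "ae U P" and PQ: "\<And>x. P x \<Longrightarrow> Q x"
  have "(\<lambda>x. P x \<and> Q x) = P" using PQ by blast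
  thus "ae U Q" using ultra_conj[OF U(1), of P Q] U(2) by simp
qed

lemma ultra_mp: "ultra U \<Longrightarrow> ae U P \<Longrightarrow> ae U (\<lambda>x. P x \<longrightarrow> Q x) \<Longrightarrow> ae U Q"
  using ultra_conj[of U P "\<lambda>x. P x \<longrightarrow> Q x"] ultra_mono[of U "\<lambda>x. P x \<and> (P x \<longrightarrow> Q x)" Q] by simp

lemma ultra_cong_ae:
  assumes U: "ultra U" and eq: "ae U (\<lambda>x. P x \<longleftrightarrow> Q x)"
  shows "ae U P \<longleftrightarrow> ae U Q"
proof -
  have "ae U (\<lambda>x. P x \<longrightarrow> Q x)" by (rule ultra_mono[OF U eq]) simp
  moreover have "ae U (\<lambda>x. Q x \<longrightarrow> P x)" by (rule ultra_mono[OF U eq]) simp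
  ultimately show ?thesis using ultra_mp[OF U] by blast
qed

lemma ultra_ex: "ultra U \<Longrightarrow> ae U P \<Longrightarrow> \<exists>x. P x"
  using ultra_const[of U False] ultra_mono[of U P "\<lambda>x. False"] by blast

lemma ultra_ball:
  assumes "ultra U" "finite I"
  shows "ae U (\<lambda>x. \<forall>i\<in>I. P i x) \<longleftrightarrow> (\<forall>i\<in>I. ae U (P i))"
  using assms(2)
proof (induct I rule: finite_induct)
  case empty
  show ?case using ultra_const[OF assms(1), of True] by simp
next
  case (insert j F)
  then show ?case using ultra_conj[OF assms(1), of "P j" "\<lambda>x. \<forall>i\<in>F. P i x"] by simp
qed

text \<open>Zorn's lemma gives a family that is maximal with the finite intersection property. By
  maximality it contains every set that meets all its finite intersections, and both ultrafilter
  laws follow from this.\<close>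

lemma ultrafilter_of_fip:
  fixes B :: "'a set set"
  assumes fip: "\<And>C. finite C \<Longrightarrow> C \<subseteq> B \<Longrightarrow> \<Inter>C \<noteq> {}"
  shows "\<exists>Q. ultra Q \<and> B \<subseteq> Q"
proof -
  define fipf :: "'a set set \<Rightarrow> bool" where
    "fipf = (\<lambda>S. \<forall>C. finite C \<and> C \<subseteq> S \<longrightarrow> \<Inter>C \<noteq> {})"
  define \<A> where "\<A> = {S. B \<subseteq> S \<and> fipf S}"
  have "\<exists>Q\<in>\<A>. \<forall>X\<in>\<A>. Q \<subseteq> X \<longrightarrow> X = Q"
  proof (rule subset_Zorn_nonempty)
    show "\<A> \<noteq> {}" unfolding \<A>_def fipf_def using fip by blast
  next
    fix \<C> assume ne: "\<C> \<noteq> {}" and ch: "subset.chain \<A> \<C>"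
    have sub: "\<C> \<subseteq> \<A>" using ch by (auto simp: subset.chain_def)
    have "\<Inter>C \<noteq> {}" if C: "finite C" "C \<subseteq> \<Union>\<C>" for C
    proof -
      obtain X where X: "X \<in> \<C>" "C \<subseteq> X"
        using finite_subset_Union_chain[OF C(1) C(2) ne ch] by blast
      have "fipf X" using X(1) sub unfolding \<A>_def by blast
      thus ?thesis using C(1) X(2) unfolding fipf_def by blast
    qed
    hence "fipf (\<Union>\<C>)" unfolding fipf_def by blast
    thus "\<Union>\<C> \<in> \<A>" using ne sub unfolding \<A>_def by blast
  qed
  then obtain Q where QA: "Q \<in> \<A>" and max0: "\<forall>X\<in>\<A>. Q \<subseteq> X \<longrightarrow> X = Q" by (elim bexE)
  have Q: "B \<subseteq> Q" "fipf Q" using QA unfolding \<A>_def by simp_all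
  have max: "X = Q" if "fipf X" "Q \<subseteq> X" for X
  proof -
    have "X \<in> \<A>" using that Q(1) unfolding \<A>_def by auto
    thus ?thesis using max0 that(2) by simp
  qed
  have fin: "\<Inter>C \<noteq> {}" if "finite C" "C \<subseteq> Q" for C using that Q(2) unfolding fipf_def by blast
  have add: "P \<in> Q" if P: "\<And>C. finite C \<Longrightarrow> C \<subseteq> Q \<Longrightarrow> P \<inter> \<Inter>C \<noteq> {}" for P
  proof -
    have "fipf (insert P Q)"
      unfolding fipf_def
    proof (intro allI impI, elim conjE)
      fix C assume C: "finite C" "C \<subseteq> insert P Q"
      have "P \<inter> \<Inter>(C - {P}) \<noteq> {}" using P[of "C - {P}"] C by blast
      moreover have "P \<inter> \<Inter>(C - {P}) \<subseteq> \<Inter>C" by blast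
      ultimately show "\<Inter>C \<noteq> {}" by blast
    qed
    thus ?thesis using max[of "insert P Q"] by auto
  qed
  have up: "P \<in> Q" if C: "finite C" "C \<subseteq> Q" "\<Inter>C \<subseteq> P" for P C
  proof (rule add)
    fix C' assume C': "finite C'" "C' \<subseteq> Q"
    have "\<Inter>(C \<union> C') \<noteq> {}" using fin[of "C \<union> C'"] C C' by simp
    thus "P \<inter> \<Inter>C' \<noteq> {}" using C(3) by (auto simp: Inter_Un_distrib)
  qed
  have "- P \<in> Q \<longleftrightarrow> P \<notin> Q" for P
  proof
    show "P \<notin> Q" if "- P \<in> Q" using fin[of "{P, - P}"] that by auto
    show "- P \<in> Q" if "P \<notin> Q"
    proof -
      have "\<not> (\<forall>C. finite C \<longrightarrow> C \<subseteq> Q \<longrightarrow> P \<inter> \<Inter>C \<noteq> {})" using add[of P] that by auto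
      then obtain C where C: "finite C" "C \<subseteq> Q" "P \<inter> \<Inter>C = {}" by auto
      show ?thesis by (rule up[OF C(1,2)]) (use C(3) in blast)
    qed
  qed
  moreover have "P \<inter> R \<in> Q \<longleftrightarrow> P \<in> Q \<and> R \<in> Q" for P R
  proof (intro iffI conjI)
    show "P \<in> Q" "R \<in> Q" if "P \<inter> R \<in> Q" using that up[of "{P \<inter> R}"] by simp_all
    show "P \<inter> R \<in> Q" if "P \<in> Q \<and> R \<in> Q" using that up[of "{P, R}" "P \<inter> R"] by simp
  qed
  ultimately show ?thesis using Q(1) unfolding ultra_def by blast
qed

lemma ultra_ex_of_fip:
  assumes fip: "\<And>J. finite J \<Longrightarrow> J \<subseteq> I \<Longrightarrow> \<exists>x. \<forall>i\<in>J. P i x"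
  shows "\<exists>U. ultra U \<and> (\<forall>i\<in>I. ae U (P i))"
proof -
  have "\<exists>U. ultra U \<and> (\<lambda>i. Collect (P i)) ` I \<subseteq> U"
  proof (rule ultrafilter_of_fip)
    fix C assume "finite C" "C \<subseteq> (\<lambda>i. Collect (P i)) ` I"
    then obtain J where J: "J \<subseteq> I" "finite J" "C = (\<lambda>i. Collect (P i)) ` J"
      by (meson finite_subset_image)
    show "\<Inter>C \<noteq> {}" using fip[OF J(2,1)] unfolding J(3) by blast
  qed
  thus ?thesis unfolding ae_def by (simp add: image_subset_iff)
qed

lemma ultra_of_finite_subsets:
  "\<exists>U. ultra U \<and> ae U (\<lambda>t. finite t \<and> t \<subseteq> K) \<and> (\<forall>j\<in>K. ae U (\<lambda>t. j \<in> t))"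
proof -
  \<comment> \<open>The index \<open>None\<close> keeps the requirement on \<open>t\<close> in force
    when \<open>K\<close> is empty; the indices \<open>Some j\<close> make the ultrafilter
    fine.\<close>
  define P where "P = (\<lambda>a t. finite t \<and> t \<subseteq> K \<and> (case a of None \<Rightarrow> True | Some j \<Rightarrow> j \<in> t))"
  have "\<exists>U. ultra U \<and> (\<forall>a\<in>insert None (Some ` K). ae U (P a))"
  proof (rule ultra_ex_of_fip)
    fix J assume J: "finite J" "J \<subseteq> insert None (Some ` K)"
    have "{j. Some j \<in> J} = Some -` J" by auto
    hence "finite {j. Some j \<in> J}" using finite_vimageI[OF J(1), of Some] by simp
    hence "P a {j. Some j \<in> J}" if "a \<in> J" for a
      using J(2) that unfolding P_def by (auto split: option.splits)
    thus "\<exists>x. \<forall>a\<in>J. P a x" by blast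
  qed
  then obtain U where U: "ultra U" "ae U (P None)" "\<And>j. j \<in> K \<Longrightarrow> ae U (P (Some j))" by auto
  have "ae U (\<lambda>t. finite t \<and> t \<subseteq> K)" using U(2) by (simp add: P_def)
  moreover have "ae U (\<lambda>t. j \<in> t)" if "j \<in> K" for j
    by (rule ultra_mono[OF U(1) U(3)[OF that]]) (simp add: P_def)
  ultimately show ?thesis using U(1) by blast
qed

section \<open>Tensor powers of an ultrafilter and their limit\<close>

definition depends_below :: "nat \<Rightarrow> ((nat \<Rightarrow> 't) \<Rightarrow> 'a) \<Rightarrow> bool" where
  "depends_below d F \<longleftrightarrow> (\<forall>s s'. (\<forall>i<d. s i = s' i) \<longrightarrow> F s = F s')"

lemma depends_below_mono: "depends_below d F \<Longrightarrow> d \<le> d' \<Longrightarrow> depends_below d' F"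
  unfolding depends_below_def by auto

text \<open>The newest coordinate is quantified first, so that it is small compared with everything
  that was defined from the older ones.\<close>

primrec tensor_power :: "'t set set \<Rightarrow> nat \<Rightarrow> (nat \<Rightarrow> 't) set set" where
  "tensor_power U 0 = {X. (\<lambda>_. undefined) \<in> X}"
| "tensor_power U (Suc d) = {X. ae U (\<lambda>t. ae (tensor_power U d) (\<lambda>s. s(d := t) \<in> X))}"

lemma ae_tensor_power_Suc:
  "ae (tensor_power U (Suc d)) P \<longleftrightarrow> ae U (\<lambda>t. ae (tensor_power U d) (\<lambda>s. P (s(d := t))))"
  by (subst ae_def) simp

lemma ultra_tensor_power:
  assumes U: "ultra U"
  shows "ultra (tensor_power U d)"
proof (induct d)
  case 0
  then show ?case by (simp add: ultra_def)
next
  case (Suc d)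
  show ?case by (rule ultra_iff) (simp_all only: ae_tensor_power_Suc ultra_not[OF U] ultra_not[OF
      Suc]
        ultra_conj[OF U] ultra_conj[OF Suc])
qed

text \<open>A coordinate that \<open>P\<close> does not read only puts a quantifier in front of a
  constant, and \<open>ultra_const\<close> removes it.\<close>

lemma tensor_power_depends:
  assumes U: "ultra U" and P: "depends_below d P" and "d \<le> e"
  shows "ae (tensor_power U e) P \<longleftrightarrow> ae (tensor_power U d) P"
  using \<open>d \<le> e\<close>
proof (induct e rule: dec_induct)
  case (step e)
  have "P (s(e := t)) = P s" for s t
    using P step.hyps(1) unfolding depends_below_def by simp
  thus ?case using step by (simp add: ae_tensor_power_Suc ultra_const[OF U] del: tensor_power.simps)
qed simp

text \<open>A Fubini rule for infinitely many coordinates at once: coordinate \<open>d\<close> is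
  generic for \<open>U\<close> over everything read from the coordinates below
  \<open>d\<close>.\<close>

lemma iterated_tensor_power:
  fixes U :: "'t set set"
  assumes U: "ultra U"
  shows "\<exists>V. ultra V \<and> (\<forall>d P. (\<forall>t. depends_below d (P t)) \<longrightarrow>
    ae V (\<lambda>s :: nat \<Rightarrow> 't. P (s d) s) = ae U (\<lambda>t. ae V (P t)))"
proof -
  \<comment> \<open>The finite tensor powers are put together along an ultrafilter on the natural
    numbers that contains all final segments.\<close>
  have "\<exists>W. ultra W \<and> (\<forall>n\<in>UNIV. ae W (\<lambda>m :: nat. n \<le> m))"
  proof (rule ultra_ex_of_fip)
    fix J :: "nat set" assume "finite J"
    then show "\<exists>x. \<forall>n\<in>J. n \<le> x" using finite_nat_set_iff_bounded_le by blast
  qed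
  then obtain W :: "nat set set" where W: "ultra W" "\<And>n. ae W (\<lambda>m. n \<le> m)" by auto
  define V where "V = {X. ae W (\<lambda>d. ae (tensor_power U d) (\<lambda>s. s \<in> X))}"
  have aeV: "ae V P \<longleftrightarrow> ae W (\<lambda>d. ae (tensor_power U d) P)" for P
    by (subst ae_def) (simp add: V_def)
  have V: "ultra V"
    by (rule ultra_iff) (simp_all only: aeV ultra_not[OF W(1)] ultra_conj[OF W(1)]
        ultra_not[OF ultra_tensor_power[OF U]] ultra_conj[OF ultra_tensor_power[OF U]])
  \<comment> \<open>For an event that reads finitely many coordinates the tensor powers eventually
    agree, so \<open>V\<close> gives it their common value.\<close>
  have Vd: "ae V P \<longleftrightarrow> ae (tensor_power U d) P" if "depends_below d P" for P d
  proof -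
    have "ae W (\<lambda>e. ae (tensor_power U e) P \<longleftrightarrow> ae (tensor_power U d) P)"
      by (rule ultra_mono[OF W(1) W(2)[of d]]) (rule tensor_power_depends[OF U that])
    from ultra_cong_ae[OF W(1) this] show ?thesis by (simp add: aeV ultra_const[OF W(1)])
  qed
  have "ae V (\<lambda>s. P (s d) s) = ae U (\<lambda>t. ae V (P t))" if P: "\<And>t. depends_below d (P t)" for d and
      P :: "'t \<Rightarrow> _"
  proof -
    have "depends_below (Suc d) (\<lambda>s. P (s d) s)"
      unfolding depends_below_def
    proof (intro allI impI)
      fix s s' :: "nat \<Rightarrow> 't" assume "\<forall>i<Suc d. s i = s' i"
      moreover from this have "P (s d) s = P (s d) s'" using P[of "s d"] unfolding
          depends_below_def by simp
      ultimately show "P (s d) s = P (s' d) s'" by simp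
    qed
    hence "ae V (\<lambda>s. P (s d) s) = ae U (\<lambda>t. ae (tensor_power U d) (\<lambda>s. P t (s(d := t))))"
      by (simp add: Vd ae_tensor_power_Suc del: tensor_power.simps)
    also have "(\<lambda>t. ae (tensor_power U d) (\<lambda>s. P t (s(d := t)))) = (\<lambda>t. ae (tensor_power U d) (P
        t))"
    proof
      fix t
      have "P t (s(d := t)) = P t s" for s
        using P[of t] unfolding depends_below_def by simp
      thus "ae (tensor_power U d) (\<lambda>s. P t (s(d := t))) = ae (tensor_power U d) (P t)" by simp
    qed
    finally show ?thesis by (simp add: Vd[OF P])
  qed
  with V show ?thesis by blast
qed

section \<open>Satisfaction and substitution\<close>

lemma val_cong: "(\<And>i. i \<in> fv_tm t \<Longrightarrow> e i = e' i) \<Longrightarrow> val M e t = val M e' t"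
proof (induct t)
  case (Fun f ts)
  have "map (val M e) ts = map (val M e') ts" using Fun by auto
  then show ?case by (simp only: val.simps)
qed simp

lemma sat_cong: "(\<And>i. i \<in> fv \<phi> \<Longrightarrow> e i = e' i) \<Longrightarrow> sat M e \<phi> \<longleftrightarrow> sat M e' \<phi>"
proof (induct \<phi> arbitrary: e e')
  case (Eq s t)
  then show ?case using val_cong[of s e e' M] val_cong[of t e e' M] by simp
next
  case (Rel r ts)
  have "val M e t = val M e' t" if "t \<in> set ts" for t
    by (rule val_cong) (use Rel that in auto)
  hence "map (val M e) ts = map (val M e') ts" by simp
  then show ?case by (simp only: sat.simps)
next
  case (And \<phi> \<psi>)
  have "sat M e \<phi> = sat M e' \<phi>" "sat M e \<psi> = sat M e' \<psi>"
    by (rule And(1), use And(3) in simp, rule And(2), use And(3) in simp)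
  then show ?case by simp
next
  case (Ex \<phi>)
  have "sat M (case_nat a e) \<phi> = sat M (case_nat a e') \<phi>" for a
  proof (rule Ex(1))
    fix i assume "i \<in> fv \<phi>"
    then show "case_nat a e i = case_nat a e' i" using Ex(2)[of "i - 1"] by (cases i) auto
  qed
  then show ?case by simp
next
  case (Neg \<phi>)
  have "sat M e \<phi> = sat M e' \<phi>" by (rule Neg(1)) (use Neg(2) in simp)
  then show ?case by simp
qed simp

lemma val_rename: "val M e (rename_tm \<sigma> t) = val M (e \<circ> \<sigma>) t"
proof (induct t)
  case (Fun f ts)
  have "map (val M e \<circ> rename_tm \<sigma>) ts = map (val M (e \<circ> \<sigma>)) ts" using Fun by (simp add: comp_def)
  then show ?case by (simp only: val.simps rename_tm.simps map_map)
qed simp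

lemma sat_rename: "sat M e (rename \<sigma> \<phi>) \<longleftrightarrow> sat M (e \<circ> \<sigma>) \<phi>"
proof (induct \<phi> arbitrary: e \<sigma>)
  case (Rel r ts)
  have "map (val M e \<circ> rename_tm \<sigma>) ts = map (val M (e \<circ> \<sigma>)) ts" by (simp add: val_rename)
  then show ?case by (simp only: sat.simps rename.simps map_map)
next
  case (Ex \<phi>)
  have "case_nat a e \<circ> case_nat 0 (\<lambda>i. Suc (\<sigma> i)) = case_nat a (e \<circ> \<sigma>)" for a
    by (auto simp: fun_eq_iff split: nat.splits)
  then show ?case by (simp only: rename.simps sat.simps Ex)
qed (simp_all only: rename.simps sat.simps val_rename)

lemma fv_rename_tm: "fv_tm (rename_tm \<sigma> t) = \<sigma> ` fv_tm t"
  by (induct t) auto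

lemma fv_rename: "fv (rename \<sigma> \<phi>) = \<sigma> ` fv \<phi>"
proof (induct \<phi> arbitrary: \<sigma>)
  case (Ex \<phi>)
  have "{i. Suc i \<in> case_nat 0 (\<lambda>i. Suc (\<sigma> i)) ` A} = \<sigma> ` {i. Suc i \<in> A}" for A
  proof (intro set_eqI iffI)
    fix i assume "i \<in> {i. Suc i \<in> case_nat 0 (\<lambda>i. Suc (\<sigma> i)) ` A}"
    then obtain j where "j \<in> A" "Suc i = case_nat 0 (\<lambda>i. Suc (\<sigma> i)) j" by auto
    thus "i \<in> \<sigma> ` {i. Suc i \<in> A}" by (cases j) auto
  next
    fix i assume "i \<in> \<sigma> ` {i. Suc i \<in> A}"
    then obtain j where "Suc j \<in> A" "i = \<sigma> j" by auto
    thus "i \<in> {i. Suc i \<in> case_nat 0 (\<lambda>i. Suc (\<sigma> i)) ` A}"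
      by (intro CollectI image_eqI[of _ _ "Suc j"]) simp_all
  qed
  then show ?case by (simp only: fv.simps rename.simps Ex)
qed (auto simp: fv_rename_tm)

lemma tm_in_rename: "tm_in L (rename_tm \<sigma> t) \<longleftrightarrow> tm_in L t"
  by (induct t) auto

lemma fm_in_rename: "fm_in L (rename \<sigma> \<phi>) \<longleftrightarrow> fm_in L \<phi>"
  by (induct \<phi> arbitrary: \<sigma>) (auto simp: tm_in_rename)

lemma finite_fv_tm: "finite (fv_tm t)"
  by (induct t) auto

lemma finite_fv: "finite (fv \<phi>)"
proof (induct \<phi>)
  case (Ex \<phi>)
  have "{i. Suc i \<in> fv \<phi>} = Suc -` fv \<phi>" by auto
  then show ?case using finite_vimageI[OF Ex, of Suc] by simp
qed (auto simp: finite_fv_tm)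

lemma tm_in_mono: "sublanguage L L1 \<Longrightarrow> tm_in L t \<Longrightarrow> tm_in L1 t"
  by (induct t) (auto simp: sublanguage_def)

lemma fm_in_mono: "sublanguage L L1 \<Longrightarrow> fm_in L \<phi> \<Longrightarrow> fm_in L1 \<phi>"
  by (induct \<phi>) (auto simp: tm_in_mono, auto simp: sublanguage_def)

text \<open>Iterated negations of \<open>Bot\<close> are formulas of every language. Hence a
  cardinal that bounds the number of formulas is infinite.\<close>

lemma infinite_formulas: "infinite (formulas L)"
proof -
  have inj: "inj (\<lambda>n. (Neg ^^ n) Bot)"
  proof (rule injI)
    fix m n show "(Neg ^^ m) Bot = (Neg ^^ n) Bot \<Longrightarrow> m = n"
    proof (induct m arbitrary: n)
      case 0
      then show ?case by (cases n) auto
    next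
      case (Suc m)
      then show ?case by (cases n) auto
    qed
  qed
  have "(Neg ^^ n) Bot \<in> formulas L" for n
    by (induct n) (auto simp: formulas_def)
  hence "range (\<lambda>n. (Neg ^^ n) Bot) \<subseteq> formulas L" by blast
  thus ?thesis using finite_imageD[OF _ inj] finite_subset infinite_UNIV_nat by blast
qed

section \<open>Approximating ultrafilters when half graphs are bounded\<close>

lemma strict_mono_enum:
  assumes "finite S" "h \<le> card S"
  shows "\<exists>f :: nat \<Rightarrow> nat. (\<forall>i<h. f i \<in> S) \<and> (\<forall>i<h. \<forall>j<h. f i \<le> f j \<longleftrightarrow> i \<le> j)"
proof -
  let ?l = "sorted_list_of_set S"
  have len: "length ?l = card S" by simp
  have "?l ! i \<in> S" if "i < h" for i
    using that assms nth_mem[of i ?l] by simp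
  moreover have "?l ! i \<le> ?l ! j \<longleftrightarrow> i \<le> j" if "i < h" "j < h" for i j
  proof -
    have "sorted_wrt (<) ?l" by (rule strict_sorted_list_of_set)
    hence "?l ! i' < ?l ! j'" if "i' < j'" "j' < card S" for i' j'
      using that len by (simp add: sorted_wrt_iff_nth_less)
    thus ?thesis using that assms(2) by (metis leD leI less_le_trans nless_le)
  qed
  ultimately show ?thesis by blast
qed

context
  fixes D :: "'x set set" and X :: "'x set" and Y :: "'y set" and R :: "'x \<Rightarrow> 'y \<Rightarrow> bool"
  assumes D: "ultra D" and DX: "ae D (\<lambda>x. x \<in> X)"
begin

definition deviates :: "'x \<Rightarrow> 'y \<Rightarrow> bool" where
  "deviates x y \<longleftrightarrow> R x y \<noteq> ae D (\<lambda>x. R x y)"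

lemma ae_not_deviates: "ae D (\<lambda>x. \<not> deviates x y)"
proof (cases "ae D (\<lambda>x. R x y)")
  case True
  then show ?thesis unfolding deviates_def by simp
next
  case False
  hence "ae D (\<lambda>x. \<not> R x y)" by (simp add: ultra_not[OF D])
  with False show ?thesis unfolding deviates_def by simp
qed

text \<open>An iterated quantifier: for almost every x1, then for almost every x2, and so on for
  \<open>r\<close> new points, a single \<open>y\<close> deviates at all of them and at all of
  \<open>l\<close>. Whether \<open>deviation k []\<close> holds decides between a long half graph
  and good approximations.\<close>

primrec deviation :: "nat \<Rightarrow> 'x list \<Rightarrow> bool" where
  "deviation 0 l \<longleftrightarrow> (\<exists>y\<in>Y. \<forall>x\<in>set l. deviates x y)"
| "deviation (Suc r) l \<longleftrightarrow> ae D (\<lambda>x. deviation r (x # l))"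

lemma deviation_witness: "deviation r l \<Longrightarrow> \<exists>y\<in>Y. \<forall>x\<in>set l. deviates x y"
proof (induct r arbitrary: l)
  case (Suc r)
  then have "ae D (\<lambda>x. deviation r (x # l))" by simp
  then obtain x where "deviation r (x # l)" using ultra_ex[OF D] by blast
  then show ?case using Suc(1)[of "x # l"] by auto
qed simp

text \<open>Points are chosen one at a time. Almost every new \<open>x\<close> is free of deviation
  for the finitely many earlier \<open>y\<close> and keeps the iterated quantifier true; the next
  \<open>y\<close> is a witness deviating at all \<open>x\<close> chosen so far. It deviates at the
  newest one too, hence \<le> and not <.\<close>

lemma half_graph_of_deviation:
  assumes "deviation k []" "j \<le> k"
  shows "\<exists>xs ys. (\<forall>i<j. xs i \<in> X \<and> ys i \<in> Y) \<and> (\<forall>i<j. \<forall>i'<j. deviates (xs i) (ys i') \<longleftrightarrow> i \<le> i') \<and>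
     deviation (k - j) (map xs (rev [0..<j]))"
  using assms(2)
proof (induct j)
  case 0
  then show ?case using assms(1) by simp
next
  case (Suc j)
  then obtain xs ys where IH: "\<forall>i<j. xs i \<in> X \<and> ys i \<in> Y" "\<forall>i<j. \<forall>i'<j. deviates (xs i) (ys i') \<longleftrightarrow>
      i \<le> i'"
    "deviation (k - j) (map xs (rev [0..<j]))" by auto
  let ?l = "map xs (rev [0..<j])"
  have "k - j = Suc (k - Suc j)" using Suc(2) by simp
  hence "ae D (\<lambda>x. deviation (k - Suc j) (x # ?l))" using IH(3) by simp
  moreover have "ae D (\<lambda>x. \<forall>i\<in>{..<j}. \<not> deviates x (ys i))"
    by (simp add: ultra_ball[OF D] ae_not_deviates)
  ultimately have "ae D (\<lambda>x. deviation (k - Suc j) (x # ?l) \<and> (\<forall>i\<in>{..<j}. \<not> deviates x (ys i)) \<and> x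
      \<in> X)"
    using DX by (simp only: ultra_conj[OF D] simp_thms)
  then obtain x where x: "deviation (k - Suc j) (x # ?l)" "\<forall>i<j. \<not> deviates x (ys i)" "x \<in> X"
    using ultra_ex[OF D] by fastforce
  obtain y where y: "y \<in> Y" "\<forall>x'\<in>set (x # ?l). deviates x' y" using deviation_witness[OF x(1)] by
      blast
  let ?xs = "xs(j := x)" and ?ys = "ys(j := y)"
  have "map ?xs (rev [0..<Suc j]) = x # ?l" by simp
  hence "deviation (k - Suc j) (map ?xs (rev [0..<Suc j]))" using x(1) by simp
  moreover have "\<forall>i<Suc j. ?xs i \<in> X \<and> ?ys i \<in> Y" using IH(1) x(3) y(1) by (simp add: less_Suc_eq)
  moreover have "\<forall>i<Suc j. \<forall>i'<Suc j. deviates (?xs i) (?ys i') \<longleftrightarrow> i \<le> i'"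
    using IH(2) x(2) y(2) by (auto simp: less_Suc_eq)
  ultimately show ?case by blast
qed

lemma subseqs_filter:
  "k \<le> length (filter Q xs) \<Longrightarrow> \<exists>l\<in>set (subseqs xs). length l = k \<and> (\<forall>x\<in>set l. Q x)"
proof (induct xs arbitrary: k)
  case (Cons x xs)
  show ?case
  proof (cases "Q x \<and> k \<noteq> 0")
    case True
    then obtain k' where k': "k = Suc k'" by (cases k) auto
    with Cons(2) True obtain l where "l \<in> set (subseqs xs)" "length l = k'" "\<forall>x\<in>set l. Q x"
      using Cons(1)[of k'] by auto
    then show ?thesis using True k' by (auto simp: Let_def intro!: bexI[of _ "x # l"])
  next
    case False
    then have "k \<le> length (filter Q xs)" using Cons(2) by (auto split: if_splits)
    then show ?thesis using Cons(1)[of k] by (auto simp: Let_def)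
  qed
qed simp

text \<open>The other side of the dichotomy: points are added so that no sublist of length at most
  \<open>k\<close> satisfies the rest of its iterated quantifier. At length \<open>k\<close> nothing
  is left to quantify, so no \<open>y\<close> deviates on a whole sublist of \<open>k\<close>
  points.\<close>

lemma approximation_of_not_deviation:
  assumes "\<not> deviation k []"
  shows "\<exists>xs. length xs = m \<and> set xs \<subseteq> X \<and> (\<forall>y\<in>Y. length (filter (\<lambda>x. deviates x y) xs) < k)"
proof -
  have "\<exists>xs. length xs = m \<and> set xs \<subseteq> X \<and>
    (\<forall>l\<in>set (subseqs xs). length l \<le> k \<longrightarrow> \<not> deviation (k - length l) l)"
  proof (induct m)
    case 0
    then show ?case using assms by simp
  next
    case (Suc m)
    then obtain xs where xs: "length xs = m" "set xs \<subseteq> X"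
      "\<And>l. l \<in> set (subseqs xs) \<Longrightarrow> length l \<le> k \<Longrightarrow> \<not> deviation (k - length l) l" by blast
    \<comment> \<open>Only finitely many sublists can be extended by the new point, so almost every
      point is good for all of them at once.\<close>
    have "ae D (\<lambda>x. \<forall>l\<in>{l \<in> set (subseqs xs). length l < k}. \<not> deviation (k - Suc (length l)) (x #
        l))"
    proof (subst ultra_ball[OF D])
      show "\<forall>l\<in>{l \<in> set (subseqs xs). length l < k}. ae D (\<lambda>x. \<not> deviation (k - Suc (length l)) (x
          # l))"
      proof clarify
        fix l assume l: "l \<in> set (subseqs xs)" "length l < k"
        have "k - length l = Suc (k - Suc (length l))" using l(2) by simp
        then show "ae D (\<lambda>x. \<not> deviation (k - Suc (length l)) (x # l))"
          using xs(3)[OF l(1)] l(2) by (simp add: ultra_not[OF D])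
      qed
    qed simp
    hence "ae D (\<lambda>x. (\<forall>l\<in>{l \<in> set (subseqs xs). length l < k}. \<not> deviation (k - Suc (length l)) (x
        # l)) \<and> x \<in> X)"
      using DX by (simp only: ultra_conj[OF D] simp_thms)
    then obtain x where x: "\<And>l. l \<in> set (subseqs xs) \<Longrightarrow> length l < k \<Longrightarrow> \<not> deviation (k - Suc (length
        l)) (x # l)" "x \<in> X"
      using ultra_ex[OF D] by fastforce
    show ?case
    proof (intro exI[of _ "x # xs"] conjI ballI impI)
      fix l assume "l \<in> set (subseqs (x # xs))" "length l \<le> k"
      then consider "l \<in> set (subseqs xs)" | l' where "l = x # l'" "l' \<in> set (subseqs xs)" "length
          l' < k"
        by (auto simp: Let_def)
      then show "\<not> deviation (k - length l) l"
      proof cases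
        case 1
        then show ?thesis using xs(3) \<open>length l \<le> k\<close> by blast
      next
        case 2
        then show ?thesis using x(1) by simp
      qed
    qed (use xs x(2) in auto)
  qed
  then obtain xs where xs: "length xs = m" "set xs \<subseteq> X"
    "\<forall>l\<in>set (subseqs xs). length l \<le> k \<longrightarrow> \<not> deviation (k - length l) l" by blast
  have "length (filter (\<lambda>x. deviates x y) xs) < k" if "y \<in> Y" for y
  proof (rule ccontr)
    assume "\<not> ?thesis"
    then obtain l where l: "l \<in> set (subseqs xs)" "length l = k" "\<forall>x\<in>set l. deviates x y"
      using subseqs_filter[of k "\<lambda>x. deviates x y" xs] by auto
    then have "\<not> deviation 0 l" using xs(3) by fastforce
    then show False using that l(3) by auto
  qed
  with xs show ?thesis by blast
qed

text \<open>The colours \<open>col\<close> allow finitely many relations to be treated together; in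
  the application the colour of a parameter is its formula. A half graph of deviations is thinned to
  one colour and one \<open>D\<close>-value, where deviation is \<open>R\<close> up to
  negation.\<close>

lemma approximation_of_no_half_graph:
  fixes m :: nat
  assumes Z: "finite Z" "\<And>y. y \<in> Y \<Longrightarrow> col y \<in> Z"
    and no: "\<And>b z xs ys. z \<in> Z \<Longrightarrow> \<forall>i<h. xs i \<in> X \<and> ys i \<in> Y \<and> col (ys i) = z \<Longrightarrow>
       \<forall>i<h. \<forall>j<h. (R (xs i) (ys j) = b) \<longleftrightarrow> i \<le> j \<Longrightarrow> False"
  shows "\<exists>xs. (\<forall>i<m. xs i \<in> X) \<and>
    (\<forall>y\<in>Y. card {i. i < m \<and> R (xs i) y \<noteq> ae D (\<lambda>x. R x y)} < Suc (2 * card Z * h))"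
proof -
  let ?k = "Suc (2 * card Z * h)"
  have "\<not> deviation ?k []"
  proof
    assume "deviation ?k []"
    from half_graph_of_deviation[OF this order_refl] obtain xs ys where
      xs: "\<forall>i<?k. xs i \<in> X \<and> ys i \<in> Y" "\<forall>i<?k. \<forall>i'<?k. deviates (xs i) (ys i') \<longleftrightarrow> i \<le> i'" by blast
    \<comment> \<open>There are \<open>2 * card Z\<close> pairs of a colour and a truth value, so
      \<open>Suc (2 * card Z * h)\<close> indices put at least \<open>h\<close> into one
      class.\<close>
    define g where "g i = (col (ys i), ae D (\<lambda>x. R x (ys i)))" for i
    have g: "g ` {..<?k} \<subseteq> Z \<times> UNIV" using xs(1) Z(2) by (auto simp: g_def)
    have fin: "finite (Z \<times> (UNIV :: bool set))" using Z(1) by simp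
    have "\<exists>p\<in>Z \<times> UNIV. h \<le> card {i. i < ?k \<and> g i = p}"
    proof (rule ccontr)
      assume "\<not> ?thesis"
      hence small: "card {i. i < ?k \<and> g i = p} \<le> h" if "p \<in> Z \<times> UNIV" for p
        using that by (meson nle_le)
      have "{..<?k} = (\<Union>p\<in>Z \<times> UNIV. {i. i < ?k \<and> g i = p})" using g by auto
      hence "?k = card (\<Union>p\<in>Z \<times> UNIV. {i. i < ?k \<and> g i = p})" by (metis card_lessThan)
      also have "\<dots> \<le> (\<Sum>p\<in>Z \<times> UNIV. card {i. i < ?k \<and> g i = p})" by (rule card_UN_le[OF fin])
      also have "\<dots> \<le> of_nat (card (Z \<times> (UNIV :: bool set))) * h"
        by (rule sum_bounded_above) (rule small)
      also have "\<dots> = 2 * card Z * h" by (simp add: card_cartesian_product)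
      finally show False by simp
    qed
    then obtain z b where zb: "z \<in> Z" "h \<le> card {i. i < ?k \<and> g i = (z, b)}" by auto
    obtain f :: "nat \<Rightarrow> nat" where f: "\<forall>i<h. f i \<in> {i. i < ?k \<and> g i = (z, b)}" "\<forall>i<h. \<forall>j<h. f i \<le> f
        j \<longleftrightarrow> i \<le> j"
      using strict_mono_enum[of "{i. i < ?k \<and> g i = (z, b)}" h] zb(2) by auto
    show False
    proof (rule no[OF zb(1)])
      show "\<forall>i<h. (xs \<circ> f) i \<in> X \<and> (ys \<circ> f) i \<in> Y \<and> col ((ys \<circ> f) i) = z"
        using f(1) xs(1) by (auto simp: g_def)
      \<comment> \<open>Where the \<open>D\<close>-value is \<open>b\<close>, to deviate is to have
        the opposite truth value.\<close>
      show "\<forall>i<h. \<forall>j<h. (R ((xs \<circ> f) i) ((ys \<circ> f) j) = (\<not> b)) \<longleftrightarrow> i \<le> j"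
      proof (intro allI impI)
        fix i j assume ij: "i < h" "j < h"
        have "ae D (\<lambda>x. R x (ys (f j))) = b" using f(1) ij(2) by (auto simp: g_def)
        moreover have "deviates (xs (f i)) (ys (f j)) \<longleftrightarrow> f i \<le> f j" using xs(2) f(1) ij by blast
        moreover have "f i \<le> f j \<longleftrightarrow> i \<le> j" using f(2) ij by blast
        ultimately show "(R ((xs \<circ> f) i) ((ys \<circ> f) j) = (\<not> b)) \<longleftrightarrow> i \<le> j"
          unfolding deviates_def by auto
      qed
    qed
  qed
  from approximation_of_not_deviation[OF this, of m] obtain xs where
    xs: "length xs = m" "set xs \<subseteq> X" "\<forall>y\<in>Y. length (filter (\<lambda>x. deviates x y) xs) < ?k" by blast
  show ?thesis
  proof (intro exI[of _ "\<lambda>i. xs ! i"] conjI allI impI ballI)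
    show "xs ! i \<in> X" if "i < m" for i using that xs(1,2) nth_mem by blast
    show "card {i. i < m \<and> R (xs ! i) y \<noteq> ae D (\<lambda>x. R x y)} < ?k" if "y \<in> Y" for y
      using xs(3) that xs(1) unfolding length_filter_conv_card deviates_def by simp
  qed
qed

end

section \<open>Substructures of ultrapowers\<close>

text \<open>Terms over \<open>Op\<close>, viewed as functions of the coordinates; each application
  also reads one coordinate \<open>s d\<close>. The case \<open>Fs = []\<close> starts the
  construction.\<close>

inductive_set hull :: "('u list \<Rightarrow> 'k set \<Rightarrow> 'u) set \<Rightarrow> ((nat \<Rightarrow> 'k set) \<Rightarrow> 'u) set"
  for Op where
  "h \<in> Op \<Longrightarrow> \<forall>F\<in>set Fs. F \<in> hull Op \<Longrightarrow> (\<lambda>s. h (map (\<lambda>F. F s) Fs) (s d)) \<in> hull Op"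

lemma depends_below_list:
  assumes "\<forall>F\<in>set Fs. \<exists>d. depends_below d F"
  shows "\<exists>d. depends_below d (\<lambda>s. map (\<lambda>F. F s) Fs)"
  using assms
proof (induct Fs)
  case (Cons F Fs)
  then obtain d d' where "depends_below d F" "depends_below d' (\<lambda>s. map (\<lambda>F. F s) Fs)" by auto
  hence "depends_below (max d d') F" "depends_below (max d d') (\<lambda>s. map (\<lambda>F. F s) Fs)"
    by (auto intro: depends_below_mono)
  hence "depends_below (max d d') (\<lambda>s. F s # map (\<lambda>F. F s) Fs)"
    unfolding depends_below_def by (metis (no_types, lifting))
  then show ?case by (intro exI[of _ "max d d'"]) simp
qed (simp add: depends_below_def)

lemma depends_below_hull: "F \<in> hull Op \<Longrightarrow> \<exists>d. depends_below d F"
proof (induct rule: hull.induct)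
  case (1 h Fs d)
  then obtain d' where d': "depends_below d' (\<lambda>s. map (\<lambda>F. F s) Fs)"
    using depends_below_list[of Fs] by blast
  have "depends_below (max d' (Suc d)) (\<lambda>s. h (map (\<lambda>F. F s) Fs) (s d))"
    unfolding depends_below_def
  proof (intro allI impI)
    fix s s' :: "nat \<Rightarrow> 'a set" assume *: "\<forall>i<max d' (Suc d). s i = s' i"
    have "map (\<lambda>F. F s) Fs = map (\<lambda>F. F s') Fs"
      using d'[unfolded depends_below_def, rule_format, of s s'] * by simp
    moreover have "s d = s' d" using * by simp
    ultimately show "h (map (\<lambda>F. F s) Fs) (s d) = h (map (\<lambda>F. F s') Fs) (s' d)" by (simp only:)
  qed
  then show ?case by blast
qed

lemma hull_value:
  assumes "\<And>h xs t. h \<in> Op \<Longrightarrow> set xs \<subseteq> C \<Longrightarrow> h xs t \<in> C" "F \<in> hull Op"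
  shows "F s \<in> C"
  using assms(2)
proof (induct rule: hull.induct)
  case (1 h Fs d)
  then show ?case by (intro assms(1)) auto
qed

section \<open>Cardinality of the hull\<close>

lemma card_of_Times_ordLeq:
  "infinite K \<Longrightarrow> |A| \<le>o |K| \<Longrightarrow> |B| \<le>o |K| \<Longrightarrow> |A \<times> B| \<le>o |K|"
  by (rule card_of_Times_ordLeq_infinite_Field[OF _ _ _ card_of_Card_order]) (simp_all only:
      Field_card_of not_False_eq_True)

lemma card_of_Un_ordLeq:
  "infinite K \<Longrightarrow> |A| \<le>o |K| \<Longrightarrow> |B| \<le>o |K| \<Longrightarrow> |A \<union> B| \<le>o |K|"
  by (rule card_of_Un_ordLeq_infinite_Field[OF _ _ _ card_of_Card_order]) (simp_all only:
      Field_card_of not_False_eq_True)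

lemma card_of_lists_ordLeq_infinite:
  assumes "infinite K" "|X| \<le>o |K|"
  shows "|lists X| \<le>o |K|"
proof -
  have "|{xs \<in> lists X. length xs = n}| \<le>o |K|" for n
  proof (induct n)
    case 0
    have "{xs \<in> lists X. length xs = 0} = {[]}" by auto
    then show ?case using assms(1) card_of_singl_ordLeq[of K "[]"] by auto
  next
    case (Suc n)
    have "{xs \<in> lists X. length xs = Suc n} \<subseteq> (\<lambda>(x, xs). x # xs) ` (X \<times> {xs \<in> lists X. length xs =
        n})"
      by (auto simp: length_Suc_conv image_iff)
    hence "|{xs \<in> lists X. length xs = Suc n}| \<le>o |X \<times> {xs \<in> lists X. length xs = n}|"
      by (rule surj_imp_ordLeq)
    also have "|X \<times> {xs \<in> lists X. length xs = n}| \<le>o |K|"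
      by (rule card_of_Times_ordLeq[OF assms Suc])
    finally show ?case .
  qed
  hence "|\<Union>n. {xs \<in> lists X. length xs = n}| \<le>o |K|"
    using assms(1) by (intro card_of_UNION_ordLeq_infinite) (simp_all add: infinite_iff_card_of_nat)
  moreover have "(\<Union>n. {xs \<in> lists X. length xs = n}) = lists X" by auto
  ultimately show ?thesis by simp
qed

text \<open>Terms arise in countably many stages, and neither finite lists of arguments nor the
  choice of a coordinate exceeds an infinite bound.\<close>

lemma card_of_hull:
  fixes K :: "'k set" and Op :: "('u list \<Rightarrow> 'k set \<Rightarrow> 'u) set"
  assumes K: "infinite K" and Op: "|Op| \<le>o |K|"
  shows "|hull Op| \<le>o |K|"
proof -
  define app :: "('u list \<Rightarrow> 'k set \<Rightarrow> 'u) \<times> ((nat \<Rightarrow> 'k set) \<Rightarrow> 'u) list \<times> nat \<Rightarrow> (nat \<Rightarrow> 'k set) \<Rightarrow> 'u"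
    where "app = (\<lambda>(h, Fs, d) s. h (map (\<lambda>F. F s) Fs) (s d))"
  define X where "X = rec_nat {} (\<lambda>_ A. A \<union> app ` (Op \<times> lists A \<times> UNIV))"
  have X0: "X 0 = {}" and XS: "X (Suc n) = X n \<union> app ` (Op \<times> lists (X n) \<times> UNIV)" for n
    by (simp_all add: X_def)
  have mono: "X m \<subseteq> X n" if "m \<le> n" for m n
    using that by (induct rule: dec_induct) (auto simp: XS)
  have "|X n| \<le>o |K|" for n
  proof (induct n)
    case (Suc n)
    have "|UNIV :: nat set| \<le>o |K|" using K by (simp add: infinite_iff_card_of_nat)
    hence "|Op \<times> lists (X n) \<times> (UNIV :: nat set)| \<le>o |K|"
      by (intro card_of_Times_ordLeq[OF K] Op card_of_lists_ordLeq_infinite[OF K] Suc)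
    hence "|app ` (Op \<times> lists (X n) \<times> UNIV)| \<le>o |K|"
      by (rule ordLeq_transitive[OF card_of_image])
    thus ?case unfolding XS by (rule card_of_Un_ordLeq[OF K Suc])
  qed (simp add: X0 card_of_empty)
  hence "|\<Union>n. X n| \<le>o |K|"
    using K by (intro card_of_UNION_ordLeq_infinite) (simp_all add: infinite_iff_card_of_nat)
  moreover have "hull Op \<subseteq> (\<Union>n. X n)"
  proof
    fix F assume "F \<in> hull Op"
    thus "F \<in> (\<Union>n. X n)"
    proof (induct rule: hull.induct)
      case (1 h Fs d)
      then obtain m where m: "\<And>F. F \<in> set Fs \<Longrightarrow> F \<in> X (m F)" by (metis UN_E)
      obtain n where "\<forall>k\<in>m ` set Fs. k \<le> n" using finite_nat_set_iff_bounded_le by blast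
      hence "F \<in> X n" if "F \<in> set Fs" for F using m[OF that] mono[of "m F" n] that by auto
      hence "Fs \<in> lists (X n)" by auto
      hence "app (h, Fs, d) \<in> X (Suc n)" using 1(1) by (auto simp: XS)
      thus ?case unfolding app_def by auto
    qed
  qed
  ultimately show ?thesis using card_of_mono1 ordLeq_transitive by blast
qed

section \<open>Ultraproducts of families of functions and the theorem of Los\<close>

text \<open>Models are collected with carriers inside \<open>'u\<close>, so classes modulo
  \<open>V\<close> need codes there: a member of each class is chosen and sent through an injection
  of \<open>H\<close> into \<open>'u\<close>.\<close>

lemma quotient_map:
  fixes H :: "('s \<Rightarrow> 'u) set"
  assumes V: "ultra V" and H: "|H| \<le>o |UNIV :: 'u set|"
  shows "\<exists>\<pi> :: ('s \<Rightarrow> 'u) \<Rightarrow> 'u. \<forall>F\<in>H. \<forall>G\<in>H. \<pi> F = \<pi> G \<longleftrightarrow> ae V (\<lambda>s. F s = G s)"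
proof -
  obtain h :: "('s \<Rightarrow> 'u) \<Rightarrow> 'u" where h: "inj_on h H" using H by (auto simp:
      card_of_ordLeq[symmetric])
  define r where "r F = (SOME G. G \<in> H \<and> ae V (\<lambda>s. F s = G s))" for F
  have r: "r F \<in> H \<and> ae V (\<lambda>s. F s = r F s)" if "F \<in> H" for F
    unfolding r_def by (rule someI[of _ F]) (simp add: that ultra_const[OF V])
  have tr: "ae V (\<lambda>s. F s = G s) \<Longrightarrow> ae V (\<lambda>s. G s = E s) \<Longrightarrow> ae V (\<lambda>s. F s = E s)" for F G E :: "'s \<Rightarrow>
      'u"
    using ultra_mono[OF V, of "\<lambda>s. F s = G s \<and> G s = E s" "\<lambda>s. F s = E s"] ultra_conj[OF V] by auto
  have sym: "ae V (\<lambda>s. F s = G s) \<Longrightarrow> ae V (\<lambda>s. G s = F s)" for F G :: "'s \<Rightarrow> 'u"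
    by (rule ultra_mono[OF V], assumption) simp
  have "h (r F) = h (r G) \<longleftrightarrow> ae V (\<lambda>s. F s = G s)" if FG: "F \<in> H" "G \<in> H" for F G
  proof
    assume "h (r F) = h (r G)"
    hence "r F = r G" using h r FG by (meson inj_onD)
    thus "ae V (\<lambda>s. F s = G s)" using r[OF FG(1)] r[OF FG(2)] tr sym by metis
  next
    assume *: "ae V (\<lambda>s. F s = G s)"
    \<comment> \<open>Equivalent functions have the same class, so \<open>SOME\<close> returns the
      same representative for both.\<close>
    have "ae V (\<lambda>s. F s = E s) \<longleftrightarrow> ae V (\<lambda>s. G s = E s)" for E
      using tr[OF *, of E] tr[OF sym[OF *], of E] by (rule iffI[rotated])
    hence "r F = r G" unfolding r_def by simp
    thus "h (r F) = h (r G)" by simp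
  qed
  thus ?thesis by (intro exI[of _ "\<lambda>F. h (r F)"]) blast
qed

text \<open>A small family \<open>H\<close> can replace the set of all functions. It has to be
  closed under function symbols and to contain, for each existential formula, one function that
  gives a witness wherever there is one.\<close>

locale closed_ultraproduct =
  fixes L :: "('f, 'r) language" and N :: "('f, 'r, 'u) struct"
    and V :: "'s set set" and H :: "('s \<Rightarrow> 'u) set" and \<pi> :: "('s \<Rightarrow> 'u) \<Rightarrow> 'u"
  assumes N: "is_struct L N"
    and V: "ultra V"
    and H_ne: "H \<noteq> {}"
    and H_carrier: "F \<in> H \<Longrightarrow> F s \<in> carrier N"
    and H_func: "(f, length Fs) \<in> funs L \<Longrightarrow> set Fs \<subseteq> H \<Longrightarrow> (\<lambda>s. func N f (map (\<lambda>F. F s) Fs)) \<in> H"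
    and H_wit: "fm_in L \<phi> \<Longrightarrow> set Fs \<subseteq> H \<Longrightarrow> \<exists>G\<in>H. \<forall>s. \<forall>a\<in>carrier N.
       sat N (case_nat a (\<lambda>i. map (\<lambda>F. F s) Fs ! i)) \<phi> \<longrightarrow>
       sat N (case_nat (G s) (\<lambda>i. map (\<lambda>F. F s) Fs ! i)) \<phi>"
    and \<pi>: "F \<in> H \<Longrightarrow> G \<in> H \<Longrightarrow> \<pi> F = \<pi> G \<longleftrightarrow> ae V (\<lambda>s. F s = G s)"
begin

definition lift :: "'u \<Rightarrow> 's \<Rightarrow> 'u" where
  "lift = inv_into H \<pi>"

definition prod :: "('f, 'r, 'u) struct" where
  "prod = \<lparr>carrier = \<pi> ` H,
     func = (\<lambda>f xs. \<pi> (\<lambda>s. func N f (map (\<lambda>x. lift x s) xs))),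
     rel = (\<lambda>r xs. ae V (\<lambda>s. rel N r (map (\<lambda>x. lift x s) xs)))\<rparr>"

lemma lift: "x \<in> carrier prod \<Longrightarrow> lift x \<in> H" "x \<in> carrier prod \<Longrightarrow> \<pi> (lift x) = x"
  unfolding lift_def prod_def by (simp_all add: inv_into_into f_inv_into_f)

lemma \<pi>_carrier: "F \<in> H \<Longrightarrow> \<pi> F \<in> carrier prod"
  by (simp add: prod_def)

text \<open>\<open>lift\<close> may return another representative of a class, but for finitely many
  classes the change is confined to a null set.\<close>

lemma ae_lift_map:
  assumes "set Fs \<subseteq> H"
  shows "ae V (\<lambda>s. map (\<lambda>x. lift x s) (map \<pi> Fs) = map (\<lambda>F. F s) Fs)"
proof -
  have "ae V (\<lambda>s. \<forall>F\<in>set Fs. lift (\<pi> F) s = F s)"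
  proof (subst ultra_ball[OF V], simp, rule ballI)
    fix F assume "F \<in> set Fs"
    hence F: "F \<in> H" using assms by auto
    show "ae V (\<lambda>s. lift (\<pi> F) s = F s)"
      using lift[OF \<pi>_carrier[OF F]] \<pi>[of "lift (\<pi> F)" F] F by simp
  qed
  thus ?thesis by (rule ultra_mono[OF V]) simp
qed

lemma is_struct_prod: "is_struct L prod"
proof -
  have "func prod f xs \<in> carrier prod" if "(f, n) \<in> funs L" "xs \<in> tuples n (carrier prod)" for f n
      xs
  proof -
    have "set (map lift xs) \<subseteq> H" using that(2) lift(1) by (auto simp: tuples_def)
    hence "(\<lambda>s. func N f (map (\<lambda>F. F s) (map lift xs))) \<in> H"
      using H_func[of f "map lift xs"] that by (simp add: tuples_def)
    thus ?thesis by (simp add: prod_def comp_def)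
  qed
  moreover have "carrier prod \<noteq> {}" using H_ne by (simp add: prod_def)
  ultimately show ?thesis unfolding is_struct_def by blast
qed

lemma val_prod:
  assumes F: "\<And>i. F i \<in> H"
  shows "tm_in L t \<Longrightarrow> (\<lambda>s. val N (\<lambda>i. F i s) t) \<in> H \<and>
    val prod (\<lambda>i. \<pi> (F i)) t = \<pi> (\<lambda>s. val N (\<lambda>i. F i s) t)"
proof (induct t)
  case (Var i)
  then show ?case using F by simp
next
  case (Fun f ts)
  let ?Fs = "map (\<lambda>t s. val N (\<lambda>i. F i s) t) ts"
  have Fs: "set ?Fs \<subseteq> H" using Fun by auto
  have eq: "map (val prod (\<lambda>i. \<pi> (F i))) ts = map \<pi> ?Fs" using Fun by simp
  have map_eq: "map (\<lambda>F. F s) ?Fs = map (val N (\<lambda>i. F i s)) ts" for s by simp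
  have inH: "(\<lambda>s. func N f (map (\<lambda>F. F s) ?Fs)) \<in> H" using H_func[of f ?Fs] Fun(2) Fs by simp
  have inH': "(\<lambda>s. func N f (map (\<lambda>x. lift x s) (map \<pi> ?Fs))) \<in> H"
  proof -
    have "set (map lift (map \<pi> ?Fs)) \<subseteq> H" using Fs lift(1) \<pi>_carrier by auto
    from H_func[of f, OF _ this] Fun(2) show ?thesis by (simp add: comp_def)
  qed
  have "val prod (\<lambda>i. \<pi> (F i)) (Fun f ts) = func prod f (map \<pi> ?Fs)" by (simp only: val.simps eq)
  also have "\<dots> = \<pi> (\<lambda>s. func N f (map (\<lambda>x. lift x s) (map \<pi> ?Fs)))" by (simp only: prod_def
      struct.simps)
  also have "\<dots> = \<pi> (\<lambda>s. func N f (map (\<lambda>F. F s) ?Fs))"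
    unfolding \<pi>[OF inH' inH] by (rule ultra_mono[OF V ae_lift_map[OF Fs]]) (simp only:)
  finally show ?case using inH by (simp only: map_eq val.simps simp_thms)
qed

text \<open>The theorem of Los. Connectives pass through the ultrafilter quantifier; for
  \<open>Ex\<close>, the direction from the coordinates to \<open>prod\<close> uses the witness
  function of \<open>H_wit\<close>.\<close>

lemma los:
  assumes "fm_in L \<phi>" "\<And>i. F i \<in> H"
  shows "sat prod (\<lambda>i. \<pi> (F i)) \<phi> \<longleftrightarrow> ae V (\<lambda>s. sat N (\<lambda>i. F i s) \<phi>)"
  using assms
proof (induct \<phi> arbitrary: F)
  case Bot
  then show ?case by (simp add: ultra_const[OF V])
next
  case (Eq t u)
  then show ?case using val_prod[of F t] val_prod[of F u] \<pi> by simp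
next
  case (Rel r ts)
  let ?Fs = "map (\<lambda>t s. val N (\<lambda>i. F i s) t) ts"
  have Fs: "set ?Fs \<subseteq> H" using val_prod[of F] Rel by auto
  have eq: "map (val prod (\<lambda>i. \<pi> (F i))) ts = map \<pi> ?Fs" using val_prod[of F] Rel by simp
  have map_eq: "map (\<lambda>F. F s) ?Fs = map (val N (\<lambda>i. F i s)) ts" for s by simp
  have "sat prod (\<lambda>i. \<pi> (F i)) (Rel r ts) \<longleftrightarrow> ae V (\<lambda>s. rel N r (map (\<lambda>x. lift x s) (map \<pi> ?Fs)))"
    by (simp only: sat.simps eq) (simp only: prod_def struct.simps)
  also have "\<dots> \<longleftrightarrow> ae V (\<lambda>s. rel N r (map (\<lambda>F. F s) ?Fs))"
    by (rule ultra_cong_ae[OF V], rule ultra_mono[OF V ae_lift_map[OF Fs]]) (simp only:)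
  finally show ?case by (simp only: map_eq sat.simps)
next
  case (Neg \<phi>)
  then show ?case using ultra_not[OF V] by simp
next
  case (And \<phi> \<psi>)
  then show ?case using ultra_conj[OF V] by simp
next
  case (Ex \<phi>)
  have env: "(\<lambda>i. \<pi> (case_nat G F i)) = case_nat (\<pi> G) (\<lambda>i. \<pi> (F i))"
    "(\<lambda>i. case_nat G F i s) = case_nat (G s) (\<lambda>i. F i s)" for G s
    by (auto simp: fun_eq_iff split: nat.splits)
  have IH: "sat prod (case_nat (\<pi> G) (\<lambda>i. \<pi> (F i))) \<phi> \<longleftrightarrow> ae V (\<lambda>s. sat N (case_nat (G s) (\<lambda>i. F i
      s)) \<phi>)"
    if "G \<in> H" for G
  proof -
    have "case_nat G F i \<in> H" for i using that Ex(3) by (cases i) simp_all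
    from Ex(1)[of "case_nat G F", OF _ this] Ex(2) show ?thesis by (simp add: env)
  qed
  show ?case
  proof
    assume "sat prod (\<lambda>i. \<pi> (F i)) (Ex \<phi>)"
    then obtain G where G: "G \<in> H" "sat prod (case_nat (\<pi> G) (\<lambda>i. \<pi> (F i))) \<phi>" by (auto simp:
        prod_def)
    have "ae V (\<lambda>s. sat N (case_nat (G s) (\<lambda>i. F i s)) \<phi>)" using IH[OF G(1)] G(2) by simp
    thus "ae V (\<lambda>s. sat N (\<lambda>i. F i s) (Ex \<phi>))"
      by (rule ultra_mono[OF V]) (use H_carrier[OF G(1)] in auto)
  next
    assume *: "ae V (\<lambda>s. sat N (\<lambda>i. F i s) (Ex \<phi>))"
    \<comment> \<open>\<open>H_wit\<close> takes a finite list of parameters, so the environment is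
      cut off at a bound for the free variables.\<close>
    obtain w where w: "\<And>i. Suc i \<in> fv \<phi> \<Longrightarrow> i < w"
    proof -
      obtain w where "\<forall>i\<in>fv \<phi>. i \<le> w" using finite_fv finite_nat_set_iff_bounded_le by blast
      thus ?thesis using that[of w] by (meson Suc_le_lessD)
    qed
    let ?Fs = "map F [0..<w]"
    have cong: "sat N (case_nat a (\<lambda>i. map (\<lambda>F. F s) ?Fs ! i)) \<phi> \<longleftrightarrow> sat N (case_nat a (\<lambda>i. F i s))
        \<phi>" for a s
      by (rule sat_cong) (auto split: nat.splits dest: w)
    have "set ?Fs \<subseteq> H" using Ex(3) by auto
    from H_wit[of \<phi> ?Fs, OF _ this] Ex(2)
    have "\<exists>G\<in>H. \<forall>s. \<forall>a\<in>carrier N. sat N (case_nat a (\<lambda>i. F i s)) \<phi> \<longrightarrow>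
      sat N (case_nat (G s) (\<lambda>i. F i s)) \<phi>" unfolding cong by simp
    then obtain G where G: "G \<in> H"
      "\<And>s a. a \<in> carrier N \<Longrightarrow> sat N (case_nat a (\<lambda>i. F i s)) \<phi> \<Longrightarrow> sat N (case_nat (G s) (\<lambda>i. F i s))
          \<phi>"
      by blast
    have "ae V (\<lambda>s. sat N (case_nat (G s) (\<lambda>i. F i s)) \<phi>)"
      by (rule ultra_mono[OF V *]) (use G(2) in auto)
    hence "sat prod (case_nat (\<pi> G) (\<lambda>i. \<pi> (F i))) \<phi>" using IH[OF G(1)] by simp
    thus "sat prod (\<lambda>i. \<pi> (F i)) (Ex \<phi>)" using \<pi>_carrier[OF G(1)] by auto
  qed
qed

lemma los_at:
  assumes "fm_in L \<phi>" "set Fs \<subseteq> H" "fv \<phi> \<subseteq> {..<length Fs}"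
  shows "sat_at prod \<phi> (map \<pi> Fs) \<longleftrightarrow> ae V (\<lambda>s. sat_at N \<phi> (map (\<lambda>F. F s) Fs))"
proof -
  \<comment> \<open>\<open>F0\<close> completes the list to an environment; only variables that are
    not free in the formula receive it.\<close>
  obtain F0 where F0: "F0 \<in> H" using H_ne by blast
  let ?F = "\<lambda>i. if i < length Fs then Fs ! i else F0"
  have "?F i \<in> H" for i using F0 assms(2) nth_mem by auto
  from los[of \<phi> ?F, OF assms(1) this]
  have "sat prod (\<lambda>i. \<pi> (?F i)) \<phi> \<longleftrightarrow> ae V (\<lambda>s. sat N (\<lambda>i. ?F i s) \<phi>)" .
  moreover have "sat prod (\<lambda>i. \<pi> (?F i)) \<phi> \<longleftrightarrow> sat_at prod \<phi> (map \<pi> Fs)"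
    unfolding sat_at_def by (rule sat_cong) (use assms(3) in auto)
  moreover have "sat N (\<lambda>i. ?F i s) \<phi> \<longleftrightarrow> sat_at N \<phi> (map (\<lambda>F. F s) Fs)" for s
    unfolding sat_at_def by (rule sat_cong) (use assms(3) in auto)
  ultimately show ?thesis by simp
qed

lemma prod_Mod: "N \<in> Mod L T \<Longrightarrow> T \<subseteq> sentences L \<Longrightarrow> prod \<in> Mod L T"
  using los_at[of _ "[]"] is_struct_prod
  by (simp add: Mod_def sentences_def formulas_def subset_iff ultra_const[OF V])

end

section \<open>The sequence principle\<close>

text \<open>The family \<open>g\<close> is chosen as a whole, so that its entries for different
  \<open>j\<close> and \<open>i\<close> fit together. The default is a constant from
  \<open>A\<close>, so values stay in \<open>A\<close> in either case.\<close>

definition pick :: "'u set \<Rightarrow> ('u list \<Rightarrow> 'k set \<Rightarrow> ('k \<Rightarrow> nat \<Rightarrow> 'u) \<Rightarrow> bool) \<Rightarrow>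
    'u list \<Rightarrow> 'k set \<Rightarrow> 'k \<Rightarrow> nat \<Rightarrow> 'u" where
  "pick A Q xs t = (if \<exists>g. (\<forall>j i. g j i \<in> A) \<and> Q xs t g then SOME g. (\<forall>j i. g j i \<in> A) \<and> Q xs t g
     else (\<lambda>_ _. SOME a. a \<in> A))"

lemma pick:
  assumes "\<forall>j i. g j i \<in> A" "Q xs t g"
  shows "Q xs t (pick A Q xs t)"
proof -
  have ex: "\<exists>g. (\<forall>j i. g j i \<in> A) \<and> Q xs t g" using assms by blast
  show ?thesis unfolding pick_def if_P[OF ex] using someI_ex[OF ex] by simp
qed

lemma pick_in:
  assumes "A \<noteq> {}"
  shows "pick A Q xs t j i \<in> A"
proof (cases "\<exists>g. (\<forall>j i. g j i \<in> A) \<and> Q xs t g")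
  case ex: True
  show ?thesis unfolding pick_def if_P[OF ex] using someI_ex[OF ex] by simp
next
  case no: False
  show ?thesis unfolding pick_def if_not_P[OF no] using assms by (simp add: some_in_eq)
qed

text \<open>The argument \<open>t\<close> gives Skolem functions the type of the operations in
  \<open>hull\<close>.\<close>

definition skolem :: "('f, 'r, 'u) struct \<Rightarrow> ('f, 'r) fm \<Rightarrow> 'u list \<Rightarrow> 'k set \<Rightarrow> 'u" where
  "skolem N \<phi> xs t = (if \<exists>a\<in>carrier N. sat N (case_nat a (\<lambda>i. xs ! i)) \<phi>
     then SOME a. a \<in> carrier N \<and> sat N (case_nat a (\<lambda>i. xs ! i)) \<phi> else SOME a. a \<in> carrier N)"

lemma skolem:
  assumes "a \<in> carrier N" "sat N (case_nat a (\<lambda>i. xs ! i)) \<phi>"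
  shows "sat N (case_nat (skolem N \<phi> xs t) (\<lambda>i. xs ! i)) \<phi>"
proof -
  have ex: "\<exists>a\<in>carrier N. sat N (case_nat a (\<lambda>i. xs ! i)) \<phi>" using assms by blast
  show ?thesis unfolding skolem_def if_P[OF ex] using someI_ex[OF ex[unfolded Bex_def]] by simp
qed

lemma skolem_in:
  assumes "carrier N \<noteq> {}"
  shows "skolem N \<phi> xs t \<in> carrier N"
proof (cases "\<exists>a\<in>carrier N. sat N (case_nat a (\<lambda>i. xs ! i)) \<phi>")
  case ex: True
  show ?thesis unfolding skolem_def if_P[OF ex] using someI_ex[OF ex[unfolded Bex_def]] by simp
next
  case no: False
  show ?thesis unfolding skolem_def if_not_P[OF no] using assms by (simp add: some_in_eq)
qed

text \<open>Variable 0 stands for the value and the following variables for the arguments. The value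
  is the only witness, so the Skolem function of this formula is \<open>f\<close> itself, and
  closure under Skolem functions includes closure under symbols.\<close>

definition graph_fm :: "'f \<Rightarrow> nat \<Rightarrow> ('f, 'r) fm" where
  "graph_fm f n = Eq (Fun f (map (\<lambda>i. Var (Suc i)) [0..<n])) (Var 0)"

lemma sat_graph_fm: "length xs = n \<Longrightarrow> sat N (case_nat a (\<lambda>i. xs ! i)) (graph_fm f n) \<longleftrightarrow> func N f xs
    = a"
proof -
  assume "length xs = n"
  hence "map (\<lambda>i. xs ! i) [0..<n] = xs" by (metis map_nth)
  thus ?thesis by (simp add: graph_fm_def comp_def)
qed

text \<open>If finite approximations of a sequence indexed by \<open>K\<close>, subject to a
  condition from \<open>C\<close>, exist almost everywhere, then the ultraproduct contains the sequence itself.\<close>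

locale rich_ultraproduct = closed_ultraproduct L N V H \<pi>
  for L :: "('f, 'r) language" and N :: "('f, 'r, 'u) struct"
    and V :: "'s set set" and H :: "('s \<Rightarrow> 'u) set" and \<pi> :: "('s \<Rightarrow> 'u) \<Rightarrow> 'u" +
  fixes K :: "'k set" and C :: "('u list \<Rightarrow> 'k set \<Rightarrow> ('k \<Rightarrow> nat \<Rightarrow> 'u) \<Rightarrow> bool) set"
  assumes card_H: "|H| \<le>o |K|"
    and sequence: "Q \<in> C \<Longrightarrow> set Fs \<subseteq> H \<Longrightarrow>
      (\<And>t. finite t \<Longrightarrow> t \<subseteq> K \<Longrightarrow>
         ae V (\<lambda>s. \<exists>g. (\<forall>j i. g j i \<in> carrier N) \<and> Q (map (\<lambda>F. F s) Fs) t g)) \<Longrightarrow>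
      \<exists>G. (\<forall>j\<in>K. \<forall>i. G j i \<in> H) \<and> (\<forall>J. finite J \<longrightarrow> J \<subseteq> K \<longrightarrow>
         ae V (\<lambda>s. \<exists>t g. finite t \<and> J \<subseteq> t \<and> Q (map (\<lambda>F. F s) Fs) t g \<and> (\<forall>j\<in>J. \<forall>i. G j i s = g j
             i)))"

text \<open>\<open>H\<close> is generated by Skolem functions and by functions that read an entry of
  a chosen approximation off one coordinate. Parameters from \<open>H\<close> read only coordinates
  below some \<open>d\<close>. Coordinate \<open>d\<close> is then a generic finite subset of
  \<open>K\<close>: almost everywhere it admits an approximation and contains a given finite
  \<open>J\<close>.\<close>

lemma ex_rich_ultraproduct:
  fixes N :: "('f, 'r, 'u) struct" and K :: "'k set"
  assumes N: "is_struct L N" and K: "infinite K" and L: "|formulas L| \<le>o |K|"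
    and C: "|C| \<le>o |K|" and u: "|K| \<le>o |UNIV :: 'u set|"
  shows "\<exists>V H \<pi>. rich_ultraproduct L N (V :: (nat \<Rightarrow> 'k set) set set) H \<pi> K C"
proof -
  obtain U :: "'k set set set" where U: "ultra U" "ae U (\<lambda>t. finite t \<and> t \<subseteq> K)" "\<And>j. j \<in> K \<Longrightarrow> ae U
      (\<lambda>t. j \<in> t)"
    using ultra_of_finite_subsets[of K] by blast
  obtain V :: "(nat \<Rightarrow> 'k set) set set" where V: "ultra V" and
    VU: "\<And>d P. (\<And>t. depends_below d (P t)) \<Longrightarrow> ae V (\<lambda>s. P (s d) s) = ae U (\<lambda>t. ae V (P t))"
    using iterated_tensor_power[OF U(1)] by blast
  define Op :: "('u list \<Rightarrow> 'k set \<Rightarrow> 'u) set" where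
    "Op = skolem N ` formulas L \<union> (\<lambda>(Q, j, i) xs t. pick (carrier N) Q xs t j i) ` (C \<times> K \<times> UNIV)"
  define H where "H = hull Op"
  have ne: "carrier N \<noteq> {}" using N by (simp add: is_struct_def)
  have "|C \<times> K \<times> (UNIV :: nat set)| \<le>o |K|"
    using K C by (intro card_of_Times_ordLeq) (simp_all add: infinite_iff_card_of_nat card_of_mono1)
  hence Op: "|Op| \<le>o |K|" unfolding Op_def
    by (intro card_of_Un_ordLeq[OF K] ordLeq_transitive[OF card_of_image] L)
  hence cardH: "|H| \<le>o |K|" unfolding H_def by (rule card_of_hull[OF K])
  have op_in: "h xs t \<in> carrier N" if "h \<in> Op" for h xs t
    using that ne unfolding Op_def by (auto simp: skolem_in[OF ne] pick_in[OF ne])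
  have closed: "(\<lambda>s. h (map (\<lambda>F. F s) Fs) (s d)) \<in> H" if "h \<in> Op" "set Fs \<subseteq> H" for h Fs d
    unfolding H_def by (rule hull.intros[OF that(1)]) (use that(2) in \<open>auto simp: H_def\<close>)
  have val: "F s \<in> carrier N" if "F \<in> H" for F s
    by (rule hull_value[of Op]) (use op_in that in \<open>auto simp: H_def\<close>)
  have sk: "(\<lambda>s. skolem N \<phi> (map (\<lambda>F. F s) Fs) (s 0)) \<in> H" if "fm_in L \<phi>" "set Fs \<subseteq> H" for \<phi> Fs
    by (rule closed[OF _ that(2)]) (use that(1) in \<open>auto simp: Op_def formulas_def\<close>)
  obtain \<pi> :: "((nat \<Rightarrow> 'k set) \<Rightarrow> 'u) \<Rightarrow> 'u" where \<pi>: "\<And>F G. F \<in> H \<Longrightarrow> G \<in> H \<Longrightarrow> \<pi> F = \<pi> G \<longleftrightarrow> ae V (\<lambda>s. F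
      s = G s)"
    using quotient_map[OF V ordLeq_transitive[OF cardH u]] by blast
  have "rich_ultraproduct L N V H \<pi> K C"
  proof
    show "is_struct L N" by (rule N)
    show "ultra V" by (rule V)
    have "fm_in L Bot" by simp
    from sk[OF this, of "[]"] show "H \<noteq> {}" by auto
    show "F s \<in> carrier N" if "F \<in> H" for F s by (rule val[OF that])
    show "\<pi> F = \<pi> G \<longleftrightarrow> ae V (\<lambda>s. F s = G s)" if "F \<in> H" "G \<in> H" for F G by (rule \<pi>[OF that])
    show "|H| \<le>o |K|" by (rule cardH)
  next
    fix f Fs assume f: "(f, length Fs) \<in> funs L" and Fs: "set Fs \<subseteq> H"
    let ?\<phi> = "graph_fm f (length Fs) :: ('f, 'r) fm"
    have "fm_in L ?\<phi>" using f by (auto simp: graph_fm_def)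
    from sk[OF this Fs] have "(\<lambda>s. skolem N ?\<phi> (map (\<lambda>F. F s) Fs) (s 0)) \<in> H" .
    moreover have "skolem N ?\<phi> (map (\<lambda>F. F s) Fs) (s 0) = func N f (map (\<lambda>F. F s) Fs)" for s
    proof -
      let ?xs = "map (\<lambda>F. F s) Fs"
      have "?xs \<in> tuples (length Fs) (carrier N)" using Fs val by (auto simp: tuples_def)
      hence "func N f ?xs \<in> carrier N" using N f unfolding is_struct_def by blast
      from skolem[OF this, of ?xs ?\<phi> "s 0"] show ?thesis by (simp add: sat_graph_fm)
    qed
    ultimately show "(\<lambda>s. func N f (map (\<lambda>F. F s) Fs)) \<in> H" by simp
  next
    fix \<phi> Fs assume "fm_in L \<phi>" and "set Fs \<subseteq> H"
    from sk[OF this] show "\<exists>G\<in>H. \<forall>s. \<forall>a\<in>carrier N.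
       sat N (case_nat a (\<lambda>i. map (\<lambda>F. F s) Fs ! i)) \<phi> \<longrightarrow>
       sat N (case_nat (G s) (\<lambda>i. map (\<lambda>F. F s) Fs ! i)) \<phi>"
      by (rule bexI[rotated]) (intro allI ballI impI, rule skolem)
  next
    fix Q Fs
    assume Q: "Q \<in> C" and Fs: "set Fs \<subseteq> H" and
      approx: "\<And>t. finite t \<Longrightarrow> t \<subseteq> K \<Longrightarrow> ae V (\<lambda>s. \<exists>g. (\<forall>j i. g j i \<in> carrier N) \<and> Q (map (\<lambda>F. F s)
          Fs) t g)"
    define P where "P t s = (finite t \<and> (\<exists>g. (\<forall>j i. g j i \<in> carrier N) \<and> Q (map (\<lambda>F. F s) Fs) t
        g))" for t s
    \<comment> \<open>Coordinate \<open>d\<close> is fresh for the parameters, as the Fubini rule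
      \<open>VU\<close> demands.\<close>
    obtain d where d: "depends_below d (\<lambda>s. map (\<lambda>F. F s) Fs)"
      using depends_below_list[of Fs] depends_below_hull Fs unfolding H_def by blast
    have dP: "depends_below d (P t)" for t
      unfolding depends_below_def P_def
    proof (intro allI impI)
      fix s s' :: "nat \<Rightarrow> 'k set" assume "\<forall>i<d. s i = s' i"
      hence "map (\<lambda>F. F s) Fs = map (\<lambda>F. F s') Fs" using d unfolding depends_below_def by blast
      thus "(finite t \<and> (\<exists>g. (\<forall>j i. g j i \<in> carrier N) \<and> Q (map (\<lambda>F. F s) Fs) t g)) =
        (finite t \<and> (\<exists>g. (\<forall>j i. g j i \<in> carrier N) \<and> Q (map (\<lambda>F. F s') Fs) t g))" by (simp only:)
    qed
    have "ae U (\<lambda>t. ae V (P t))"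
    proof (rule ultra_mono[OF U(1) U(2)])
      fix t assume t: "finite t \<and> t \<subseteq> K"
      show "ae V (P t)" by (rule ultra_mono[OF V approx[of t]]) (use t in \<open>simp_all add: P_def\<close>)
    qed
    hence ok: "ae V (\<lambda>s. P (s d) s)" using VU[of d P, OF dP] by simp
    have mem: "ae V (\<lambda>s. j \<in> s d)" if "j \<in> K" for j
    proof -
      have "ae V (\<lambda>s. j \<in> s d) = ae U (\<lambda>t. ae V (\<lambda>s. j \<in> t))"
        by (rule VU) (simp add: depends_below_def)
      thus ?thesis using U(3)[OF that] by (simp add: ultra_const[OF V])
    qed
    \<comment> \<open>All entries are read at the same coordinate, hence from one approximation for
      each \<open>s\<close>.\<close>
    define G where "G j i s = pick (carrier N) Q (map (\<lambda>F. F s) Fs) (s d) j i" for j i and s ::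
        "nat \<Rightarrow> 'k set"
    show "\<exists>G. (\<forall>j\<in>K. \<forall>i. G j i \<in> H) \<and> (\<forall>J. finite J \<longrightarrow> J \<subseteq> K \<longrightarrow>
         ae V (\<lambda>s. \<exists>t g. finite t \<and> J \<subseteq> t \<and> Q (map (\<lambda>F. F s) Fs) t g \<and> (\<forall>j\<in>J. \<forall>i. G j i s = g j
             i)))"
    proof (intro exI[of _ G] conjI ballI allI impI)
      fix j i assume j: "j \<in> K"
      let ?h = "\<lambda>xs t. pick (carrier N) Q xs t j i"
      have "?h \<in> (\<lambda>(Q, j, i) xs t. pick (carrier N) Q xs t j i) ` (C \<times> K \<times> UNIV)"
        by (rule image_eqI[of _ _ "(Q, j, i)"]) (use j Q in simp_all)
      hence "?h \<in> Op" unfolding Op_def by (rule UnI2)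
      from closed[OF this Fs, of d] show "G j i \<in> H" unfolding G_def[abs_def] .
    next
      fix J assume J: "finite J" "J \<subseteq> K"
      have "ae V (\<lambda>s. \<forall>j\<in>J. j \<in> s d)" using J mem by (subst ultra_ball[OF V]) auto
      with ok have "ae V (\<lambda>s. P (s d) s \<and> (\<forall>j\<in>J. j \<in> s d))" by (simp add: ultra_conj[OF V])
      thus "ae V (\<lambda>s. \<exists>t g. finite t \<and> J \<subseteq> t \<and> Q (map (\<lambda>F. F s) Fs) t g \<and> (\<forall>j\<in>J. \<forall>i. G j i s = g j
          i))"
      proof (rule ultra_mono[OF V])
        fix s assume s: "P (s d) s \<and> (\<forall>j\<in>J. j \<in> s d)"
        then obtain g where "\<forall>j i. g j i \<in> carrier N" "Q (map (\<lambda>F. F s) Fs) (s d) g" "finite (s d)"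
          unfolding P_def by blast
        from pick[of g "carrier N" Q "map (\<lambda>F. F s) Fs" "s d", OF this(1,2)] this(3) s
        show "\<exists>t g. finite t \<and> J \<subseteq> t \<and> Q (map (\<lambda>F. F s) Fs) t g \<and> (\<forall>j\<in>J. \<forall>i. G j i s = g j i)"
          by (intro exI[of _ "s d"] exI[of _ "pick (carrier N) Q (map (\<lambda>F. F s) Fs) (s d)"])
            (auto simp: G_def)
      qed
    qed
  qed
  thus ?thesis by blast
qed

section \<open>Half graphs and approximating sequences\<close>

definition half_graph :: "('f, 'r, 'u) struct \<Rightarrow> ('f, 'r) fm \<Rightarrow> nat \<Rightarrow> nat \<Rightarrow> nat \<Rightarrow> bool" where
  "half_graph M \<phi> n w h \<longleftrightarrow> (\<exists>xs ys.
     (\<forall>i<h. xs i \<in> tuples n (carrier M) \<and> ys i \<in> tuples w (carrier M)) \<and>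
     (\<forall>i<h. \<forall>j<h. sat_at M \<phi> (xs i @ ys j) \<longleftrightarrow> i < j))"

text \<open>If \<open>b\<close> is true, shifting \<open>xs\<close> by one turns \<le> into <, at
  the cost of one index. If \<open>b\<close> is false, reversing the order turns the negation of
  \<le> into <.\<close>

lemma half_graph_of_le:
  assumes t: "\<forall>i<Suc h. xs i \<in> tuples n (carrier M) \<and> ys i \<in> tuples w (carrier M)"
    and le: "\<forall>i<Suc h. \<forall>j<Suc h. (sat_at M \<phi> (xs i @ ys j) = b) \<longleftrightarrow> i \<le> j"
  shows "half_graph M \<phi> n w h"
proof (cases b)
  case True
  show ?thesis unfolding half_graph_def
    by (rule exI[of _ "\<lambda>i. xs (Suc i)"], rule exI[of _ ys]) (use t le True in auto)
next
  case False
  show ?thesis unfolding half_graph_def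
  proof (rule exI[of _ "\<lambda>i. xs (h - i)"], rule exI[of _ "\<lambda>i. ys (h - i)"], intro conjI allI impI)
    fix i j assume "i < h" "j < h"
    moreover have "(sat_at M \<phi> (xs (h - i) @ ys (h - j)) = b) \<longleftrightarrow> h - i \<le> h - j"
      by (rule le[rule_format]) simp_all
    ultimately show "sat_at M \<phi> (xs (h - i) @ ys (h - j)) \<longleftrightarrow> i < j"
      using False by arith
  qed (use t in auto)
qed

text \<open>The sequence principle takes its parameters as one list, so finitely many tuples of
  length \<open>n\<close> are concatenated by \<open>flatten\<close> and read back by
  \<open>block\<close>.\<close>

definition block :: "nat \<Rightarrow> 'a list \<Rightarrow> nat \<Rightarrow> 'a list" where
  "block n l b = map (\<lambda>i. l ! (b * n + i)) [0..<n]"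

definition flatten :: "nat \<Rightarrow> (nat \<Rightarrow> 'a list) \<Rightarrow> nat \<Rightarrow> 'a list" where
  "flatten n X r = map (\<lambda>p. X (p div n) ! (p mod n)) [0..<r * n]"

lemma block_flatten:
  assumes "b < r" "length (X b) = n"
  shows "block n (map f (flatten n X r)) b = map f (X b)"
proof (rule nth_equalityI)
  show "length (block n (map f (flatten n X r)) b) = length (map f (X b))"
    using assms by (simp add: block_def)
  fix i assume "i < length (block n (map f (flatten n X r)) b)"
  hence i: "i < n" by (simp add: block_def)
  have "b * n + i < Suc b * n" using i by simp
  also have "\<dots> \<le> r * n" using assms(1) by (intro mult_right_mono) auto
  finally have "b * n + i < r * n" .
  moreover have "(b * n + i) div n = b" "(b * n + i) mod n = i" using i by simp_all
  ultimately show "block n (map f (flatten n X r)) b ! i = map f (X b) ! i"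
    using i assms(2) by (simp add: block_def flatten_def)
qed

lemma set_flatten:
  assumes "\<And>b. b < r \<Longrightarrow> length (X b) = n \<and> set (X b) \<subseteq> A"
  shows "set (flatten n X r) \<subseteq> A"
proof -
  have "X (p div n) ! (p mod n) \<in> A" if "p < r * n" for p
  proof -
    have "n > 0" using that by (cases n) auto
    hence "p div n < r" "p mod n < n" using that by (simp_all add: less_mult_imp_div_less)
    thus ?thesis using assms[of "p div n"] nth_mem[of "p mod n" "X (p div n)"] by auto
  qed
  thus ?thesis by (auto simp: flatten_def)
qed

text \<open>With fewer than \<open>k\<close> errors among the \<open>2 * k\<close> votes, either
  more than \<open>k\<close> or fewer than \<open>k\<close> tuples satisfy the formula, so the
  threshold \<open>k\<close> recovers the intended truth value.\<close>

definition majority :: "('f, 'r, 'u) struct \<Rightarrow> ('f, 'r) fm \<Rightarrow> nat \<Rightarrow> (nat \<Rightarrow> 'u list) \<Rightarrow> 'u list \<Rightarrow>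
    bool" where
  "majority M \<phi> k e y \<longleftrightarrow> k \<le> card {b. b < 2 * k \<and> sat_at M \<phi> (e b @ y)}"

text \<open>The three conditions to which the sequence principle is applied. In the last two the
  parameters are the tuples of length \<open>n\<close> that make up \<open>xs\<close>; the first \<open>2 * k\<close> of them
  define a type by majority vote.\<close>

definition half_graph_condition :: "('f, 'r, 'u) struct \<Rightarrow> (nat \<Rightarrow> 'k) \<Rightarrow> ('f, 'r) fm \<Rightarrow> nat \<Rightarrow> nat \<Rightarrow>
    'u list \<Rightarrow> 'k set \<Rightarrow> ('k \<Rightarrow> nat \<Rightarrow> 'u) \<Rightarrow> bool" where
  "half_graph_condition N \<iota> \<phi> n w xs t g \<longleftrightarrow> (\<forall>p q. \<iota> p \<in> t \<longrightarrow> \<iota> q \<in> t \<longrightarrow>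
     (sat_at N \<phi> (map (g (\<iota> p)) [0..<n] @ map (g (\<iota> q)) [n..<n + w]) \<longleftrightarrow> p < (q :: nat)))"

definition counterexample_condition :: "('f, 'r, 'u) struct \<Rightarrow> ('f, 'r) fm \<Rightarrow> nat \<Rightarrow> nat \<Rightarrow> nat \<Rightarrow> nat \<Rightarrow>
    'u list \<Rightarrow> 'k set \<Rightarrow> ('k \<Rightarrow> nat \<Rightarrow> 'u) \<Rightarrow> bool" where
  "counterexample_condition N \<phi> n w k m xs t g \<longleftrightarrow> (\<forall>j.
     k \<le> card {b. b < m \<and> sat_at N \<phi> (block n xs (2 * k + b) @ map (g j) [0..<w]) \<noteq>
       majority N \<phi> k (block n xs) (map (g j) [0..<w])})"

definition approximation_condition :: "('f, 'r, 'u) struct \<Rightarrow> ('f, 'r) fm list \<Rightarrow> nat \<Rightarrow> nat \<Rightarrow> nat \<Rightarrow>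
    'u list \<Rightarrow> 'k set \<Rightarrow> ('k \<Rightarrow> nat \<Rightarrow> 'u) \<Rightarrow> bool" where
  "approximation_condition N \<Phi> n w k xs t g \<longleftrightarrow> (\<forall>\<phi>\<in>set \<Phi>. \<forall>y\<in>tuples w (carrier N).
     card {j \<in> t. sat_at N \<phi> (map (g j) [0..<n] @ y) \<noteq> majority N \<phi> k (block n xs) y} < k)"

text \<open>Puts the theorem of Los into a form that holds at almost every \<open>s\<close>, so that
  finitely many uses of it can be combined at a single \<open>s\<close>.\<close>

lemma ultra_ae_iff: "ultra V \<Longrightarrow> ae V (\<lambda>s. P s \<longleftrightarrow> ae V P)"
  by (cases "ae V P") (simp_all add: ultra_not)

section \<open>Transfer between \<open>N\<close> and the ultraproduct\<close>

context rich_ultraproduct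
begin

definition realized :: "('u list \<Rightarrow> 'k set \<Rightarrow> ('k \<Rightarrow> nat \<Rightarrow> 'u) \<Rightarrow> bool) \<Rightarrow> ('s \<Rightarrow> 'u) list \<Rightarrow> ('k \<Rightarrow> nat \<Rightarrow>
    's \<Rightarrow> 'u) \<Rightarrow> bool" where
  "realized Q Fs G \<longleftrightarrow> (\<forall>j\<in>K. \<forall>i. G j i \<in> H) \<and> (\<forall>J. finite J \<longrightarrow> J \<subseteq> K \<longrightarrow>
     ae V (\<lambda>s. \<exists>t g. finite t \<and> J \<subseteq> t \<and> Q (map (\<lambda>F. F s) Fs) t g \<and> (\<forall>j\<in>J. \<forall>i. G j i s = g j i)))"

lemma ex_realized:
  assumes "Q \<in> C" "set Fs \<subseteq> H" and
    "\<And>t. finite t \<Longrightarrow> t \<subseteq> K \<Longrightarrow>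
      ae V (\<lambda>s. \<exists>g. (\<forall>j i. g j i \<in> carrier N) \<and> Q (map (\<lambda>F. F s) Fs) t g)"
  shows "\<exists>G. realized Q Fs G"
  unfolding realized_def by (rule sequence[OF assms])

lemma realized_in: "realized Q Fs G \<Longrightarrow> j \<in> K \<Longrightarrow> G j i \<in> H"
  unfolding realized_def by blast

lemma ae_realized:
  assumes "realized Q Fs G" "finite J" "J \<subseteq> K"
  shows "ae V (\<lambda>s. \<exists>t g. finite t \<and> J \<subseteq> t \<and> Q (map (\<lambda>F. F s) Fs) t g \<and> (\<forall>j\<in>J. \<forall>i. G j i s = g j i))"
  using assms unfolding realized_def by simp

lemma ae_los_at:
  assumes "fm_in L \<phi>" "set Fs \<subseteq> H" "fv \<phi> \<subseteq> {..<length Fs}"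
  shows "ae V (\<lambda>s. sat_at N \<phi> (map (\<lambda>F. F s) Fs) \<longleftrightarrow> sat_at prod \<phi> (map \<pi> Fs))"
  unfolding los_at[OF assms] by (rule ultra_ae_iff[OF V])

lemma lift_tuple:
  assumes "x \<in> tuples n (carrier prod)"
  shows "set (map lift x) \<subseteq> H" "map \<pi> (map lift x) = x" "length (map lift x) = n"
proof -
  have x: "set x \<subseteq> carrier prod" "length x = n" using assms by (auto simp: tuples_def)
  show "set (map lift x) \<subseteq> H" using x(1) lift(1) by (auto simp: image_subset_iff)
  show "map \<pi> (map lift x) = x" using x(1) lift(2) by (auto intro!: map_idI)
  show "length (map lift x) = n" using x(2) by simp
qed

text \<open>A finite half graph consists of finitely many truth values. By the theorem of Los its
  representatives, evaluated at almost any \<open>s\<close>, form a half graph in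
  \<open>N\<close>.\<close>

lemma half_graph_prodD:
  assumes \<phi>: "fm_in L \<phi>" "fv \<phi> \<subseteq> {..<n + w}" and h: "half_graph prod \<phi> n w h"
  shows "half_graph N \<phi> n w h"
proof -
  obtain xs ys where t: "\<And>i. i < h \<Longrightarrow> xs i \<in> tuples n (carrier prod) \<and> ys i \<in> tuples w (carrier
      prod)"
    and R: "\<And>i j. i < h \<Longrightarrow> j < h \<Longrightarrow> sat_at prod \<phi> (xs i @ ys j) \<longleftrightarrow> i < j"
    using h unfolding half_graph_def by blast
  let ?X = "\<lambda>i s. map (\<lambda>F. F s) (map lift (xs i))" and ?Y = "\<lambda>i s. map (\<lambda>F. F s) (map lift (ys i))"
  have "ae V (\<lambda>s. \<forall>p\<in>{..<h} \<times> {..<h}. sat_at N \<phi> (?X (fst p) s @ ?Y (snd p) s) \<longleftrightarrow> fst p < snd p)"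
  proof (subst ultra_ball[OF V], simp, rule ballI)
    fix p assume p: "p \<in> {..<h} \<times> {..<h}"
    let ?Fs = "map lift (xs (fst p)) @ map lift (ys (snd p))"
    have l: "set ?Fs \<subseteq> H" "map \<pi> ?Fs = xs (fst p) @ ys (snd p)" "length ?Fs = n + w"
      using lift_tuple[of "xs (fst p)" n] lift_tuple[of "ys (snd p)" w] t[of "fst p"] t[of "snd
          p"] p
      by (simp_all add: mem_Times_iff)
    have "ae V (\<lambda>s. sat_at N \<phi> (map (\<lambda>F. F s) ?Fs) \<longleftrightarrow> sat_at prod \<phi> (map \<pi> ?Fs))"
      by (rule ae_los_at[OF \<phi>(1) l(1)]) (use \<phi>(2) l(3) in simp)
    thus "ae V (\<lambda>s. sat_at N \<phi> (?X (fst p) s @ ?Y (snd p) s) \<longleftrightarrow> fst p < snd p)"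
      using R[of "fst p" "snd p"] p unfolding l(2) by auto
  qed
  from ultra_ex[OF V this] obtain s where
    s: "\<forall>p\<in>{..<h} \<times> {..<h}. sat_at N \<phi> (?X (fst p) s @ ?Y (snd p) s) \<longleftrightarrow> fst p < snd p" by blast
  have in_t: "map (\<lambda>F. F s) (map lift x) \<in> tuples l (carrier N)" if "x \<in> tuples l (carrier prod)"
      for x l
    using that lift(1) H_carrier by (auto simp: tuples_def)
  show ?thesis unfolding half_graph_def
  proof (rule exI[of _ "\<lambda>i. ?X i s"], rule exI[of _ "\<lambda>i. ?Y i s"], intro conjI allI impI)
    show "?X i s \<in> tuples n (carrier N)" "?Y i s \<in> tuples w (carrier N)" if "i < h" for i
      using in_t t[OF that] by blast+
    show "sat_at N \<phi> (?X i s @ ?Y j s) \<longleftrightarrow> i < j" if "i < h" "j < h" for i j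
      using s[rule_format, of "(i, j)"] that by simp
  qed
qed

text \<open>The sequence principle plays the part of compactness: a finite \<open>t\<close> contains
  \<open>\<iota> p\<close> for finitely many \<open>p\<close> only, so a long half graph of
  \<open>N\<close> is an approximation, and in the limit an infinite one appears.\<close>

lemma order_property_prod:
  assumes \<phi>: "fm_in L \<phi>" "fv \<phi> \<subseteq> {..<n + w}"
    and C: "half_graph_condition N \<iota> \<phi> n w \<in> C" and \<iota>: "inj \<iota>" "range \<iota> \<subseteq> K"
    and h: "\<And>h. half_graph N \<phi> n w h"
  shows "order_property_in prod \<phi> n w"
proof -
  have ex: "\<exists>g. (\<forall>j i. g j i \<in> carrier N) \<and> half_graph_condition N \<iota> \<phi> n w xs t g" if "finite t"
      for xs t
  proof -
    have "finite (\<iota> -` t)" using finite_vimageI[OF that \<iota>(1)] .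
    then obtain h where "\<forall>p\<in>\<iota> -` t. p \<le> h" using finite_nat_set_iff_bounded_le by blast
    hence hb: "\<And>p. \<iota> p \<in> t \<Longrightarrow> p < Suc h" by (simp add: less_Suc_eq_le)
    obtain as bs where t: "\<And>i. i < Suc h \<Longrightarrow> as i \<in> tuples n (carrier N) \<and> bs i \<in> tuples w (carrier
        N)"
      and R: "\<And>i j. i < Suc h \<Longrightarrow> j < Suc h \<Longrightarrow> sat_at N \<phi> (as i @ bs j) \<longleftrightarrow> i < j"
      using h[of "Suc h"] unfolding half_graph_def by blast
    obtain x0 where x0: "x0 \<in> carrier N" using N by (auto simp: is_struct_def)
    \<comment> \<open>One sequence carries both sides of the half graph: the first \<open>n\<close>
      entries at \<open>\<iota> p\<close> are \<open>as p\<close>, the next \<open>w\<close> are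
      \<open>bs p\<close>.\<close>
    define g where "g j i = (let p = inv \<iota> j in
       if p < Suc h \<and> i < n then as p ! i else if p < Suc h \<and> i < n + w then bs p ! (i - n) else
           x0)" for j i
    have g1: "map (g (\<iota> p)) [0..<n] = as p" and g2: "map (g (\<iota> p)) [n..<n + w] = bs p" if "p < Suc
        h" for p
      using t[OF that] that \<iota>(1) by (auto intro!: nth_equalityI simp: g_def tuples_def)
    have "half_graph_condition N \<iota> \<phi> n w xs t g"
      unfolding half_graph_condition_def using R hb by (auto simp: g1 g2)
    moreover have "set (as p) \<subseteq> carrier N \<and> length (as p) = n" "set (bs p) \<subseteq> carrier N \<and> length
        (bs p) = w"
      if "p < Suc h" for p using t[OF that] by (auto simp: tuples_def)
    hence "g j i \<in> carrier N" for j i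
      using x0 by (auto simp: g_def Let_def subset_iff)
    ultimately show ?thesis by blast
  qed
  have "\<exists>G. realized (half_graph_condition N \<iota> \<phi> n w) [] G"
  proof (rule ex_realized[OF C])
    fix t :: "'k set" assume t: "finite t"
    show "ae V (\<lambda>s. \<exists>g. (\<forall>j i. g j i \<in> carrier N) \<and> half_graph_condition N \<iota> \<phi> n w (map (\<lambda>F. F s)
        []) t g)"
      by (rule ultra_mono[OF V, of "\<lambda>_. True"]) (use ex[OF t] in \<open>simp_all add: ultra_const[OF V]\<close>)
  qed simp
  then obtain G where Gr: "realized (half_graph_condition N \<iota> \<phi> n w) [] G" by blast
  note G = realized_in[OF Gr] and Gc = ae_realized[OF Gr]
  have \<iota>K: "\<iota> p \<in> K" for p using \<iota>(2) by auto
  have order: "sat_at prod \<phi> (map \<pi> (map (G (\<iota> p)) [0..<n] @ map (G (\<iota> q)) [n..<n + w])) \<longleftrightarrow> p < q"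
      for p q
  proof -
    let ?Fs = "map (G (\<iota> p)) [0..<n] @ map (G (\<iota> q)) [n..<n + w]"
    have "sat_at prod \<phi> (map \<pi> ?Fs) \<longleftrightarrow> ae V (\<lambda>s. sat_at N \<phi> (map (\<lambda>F. F s) ?Fs))"
      by (rule los_at[OF \<phi>(1)]) (use G \<iota>K \<phi>(2) in auto)
    also have "\<dots> \<longleftrightarrow> ae V (\<lambda>s. p < q)"
    proof (rule ultra_cong_ae[OF V], rule ultra_mono[OF V Gc])
      show "finite {\<iota> p, \<iota> q}" "{\<iota> p, \<iota> q} \<subseteq> K" using \<iota>K by auto
      fix s assume "\<exists>t g. finite t \<and> {\<iota> p, \<iota> q} \<subseteq> t \<and>
         half_graph_condition N \<iota> \<phi> n w (map (\<lambda>F. F s) []) t g \<and> (\<forall>j\<in>{\<iota> p, \<iota> q}. \<forall>i. G j i s = g j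
             i)"
      then obtain t g where tg0: "{\<iota> p, \<iota> q} \<subseteq> t" "\<forall>j\<in>{\<iota> p, \<iota> q}. \<forall>i. G j i s = g j i"
        and tg: "half_graph_condition N \<iota> \<phi> n w (map (\<lambda>F. F s) []) t g" by (elim exE conjE) (rule
            that)
      have "map (\<lambda>F. F s) ?Fs = map (g (\<iota> p)) [0..<n] @ map (g (\<iota> q)) [n..<n + w]"
        using tg0(2) by simp
      moreover have "sat_at N \<phi> (map (g (\<iota> p)) [0..<n] @ map (g (\<iota> q)) [n..<n + w]) \<longleftrightarrow> p < q"
        using tg tg0(1) unfolding half_graph_condition_def by simp
      ultimately show "sat_at N \<phi> (map (\<lambda>F. F s) ?Fs) \<longleftrightarrow> p < q" by (simp only:)
    qed
    finally show ?thesis by (simp add: ultra_const[OF V])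
  qed
  show ?thesis unfolding order_property_in_def
  proof (rule exI[of _ "\<lambda>p. map \<pi> (map (G (\<iota> p)) [0..<n])"],
      rule exI[of _ "\<lambda>q. map \<pi> (map (G (\<iota> q)) [n..<n + w])"], intro conjI allI)
    show "map \<pi> (map (G (\<iota> p)) [0..<n]) \<in> tuples n (carrier prod)" for p
      using G[OF \<iota>K] \<pi>_carrier by (auto simp: tuples_def)
    show "map \<pi> (map (G (\<iota> q)) [n..<n + w]) \<in> tuples w (carrier prod)" for q
      using G[OF \<iota>K] \<pi>_carrier by (auto simp: tuples_def)
    show "sat_at prod \<phi> (map \<pi> (map (G (\<iota> p)) [0..<n]) @ map \<pi> (map (G (\<iota> q)) [n..<n + w])) \<longleftrightarrow> p <
        q" for p q
      using order[of p q] by simp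
  qed
qed

lemma ae_majority:
  assumes \<phi>: "fm_in L \<phi>" "fv \<phi> \<subseteq> {..<n + w}"
    and X: "\<And>b. b < 2 * k \<Longrightarrow> length (X b) = n \<and> set (X b) \<subseteq> H" and Y: "length Y = w" "set Y \<subseteq> H"
  shows "ae V (\<lambda>s. majority N \<phi> k (\<lambda>b. map (\<lambda>F. F s) (X b)) (map (\<lambda>F. F s) Y) \<longleftrightarrow>
    majority prod \<phi> k (\<lambda>b. map \<pi> (X b)) (map \<pi> Y))"
proof -
  have "ae V (\<lambda>s. \<forall>b\<in>{..<2 * k}. sat_at N \<phi> (map (\<lambda>F. F s) (X b @ Y)) \<longleftrightarrow> sat_at prod \<phi> (map \<pi> (X b
      @ Y)))"
    by (subst ultra_ball[OF V], simp, rule ballI, rule ae_los_at[OF \<phi>(1)]) (use X Y \<phi>(2) in auto)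
  thus ?thesis
  proof (rule ultra_mono[OF V])
    fix s assume "\<forall>b\<in>{..<2 * k}. sat_at N \<phi> (map (\<lambda>F. F s) (X b @ Y)) \<longleftrightarrow> sat_at prod \<phi> (map \<pi> (X b
        @ Y))"
    hence "{b. b < 2 * k \<and> sat_at N \<phi> (map (\<lambda>F. F s) (X b) @ map (\<lambda>F. F s) Y)} =
      {b. b < 2 * k \<and> sat_at prod \<phi> (map \<pi> (X b) @ map \<pi> Y)}" by auto
    thus "majority N \<phi> k (\<lambda>b. map (\<lambda>F. F s) (X b)) (map (\<lambda>F. F s) Y) \<longleftrightarrow>
      majority prod \<phi> k (\<lambda>b. map \<pi> (X b)) (map \<pi> Y)" unfolding majority_def by simp
  qed
qed

lemma majority_cong: "(\<And>b. b < 2 * k \<Longrightarrow> e b = e' b) \<Longrightarrow> majority M \<phi> k e y = majority M \<phi> k e' y"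
  unfolding majority_def by (rule arg_cong[of _ _ "\<lambda>A. k \<le> card A"]) auto

text \<open>If the bound failed at almost every \<open>s\<close>, the sequence principle would
  collect the offending \<open>y\<close> into a tuple from \<open>H\<close>, and the image of this
  tuple would break the bound in \<open>prod\<close>.\<close>

lemma ae_no_counterexample:
  assumes \<phi>: "fm_in L \<phi>" "fv \<phi> \<subseteq> {..<n + w}" and C: "counterexample_condition N \<phi> n w k m \<in> C" and
      "K \<noteq> {}"
    and X: "\<And>b. b < 2 * k + m \<Longrightarrow> length (X b) = n \<and> set (X b) \<subseteq> H"
    and good: "\<And>y. y \<in> tuples w (carrier prod) \<Longrightarrow>
      card {b. b < m \<and> sat_at prod \<phi> (map \<pi> (X (2 * k + b)) @ y) \<noteq> majority prod \<phi> k (\<lambda>b. map \<pi> (X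
          b)) y} < k"
  shows "ae V (\<lambda>s. \<forall>y\<in>tuples w (carrier N).
    card {b. b < m \<and> sat_at N \<phi> (map (\<lambda>F. F s) (X (2 * k + b)) @ y) \<noteq>
      majority N \<phi> k (\<lambda>b. map (\<lambda>F. F s) (X b)) y} < k)" (is "ae V ?good")
proof (rule ccontr)
  assume "\<not> ae V ?good"
  hence bad: "ae V (\<lambda>s. \<not> ?good s)" by (rule iffD2[OF ultra_not[OF V]])
  let ?Fs = "flatten n X (2 * k + m)"
  have Fs: "set ?Fs \<subseteq> H" by (rule set_flatten) (use X in auto)
  have bl: "block n (map (\<lambda>F. F s) ?Fs) b = map (\<lambda>F. F s) (X b)" if "b < 2 * k + m" for b s
    by (rule block_flatten[OF that]) (use X[OF that] in simp)
  have maj: "majority N \<phi> k (block n (map (\<lambda>F. F s) ?Fs)) y = majority N \<phi> k (\<lambda>b. map (\<lambda>F. F s) (X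
      b)) y" for s y
    by (rule majority_cong) (simp add: bl)
  have cc: "counterexample_condition N \<phi> n w k m (map (\<lambda>F. F s) ?Fs) t g \<longleftrightarrow> (\<forall>j.
     k \<le> card {b. b < m \<and> sat_at N \<phi> (map (\<lambda>F. F s) (X (2 * k + b)) @ map (g j) [0..<w]) \<noteq>
       majority N \<phi> k (\<lambda>b. map (\<lambda>F. F s) (X b)) (map (g j) [0..<w])})" for s t g
    unfolding counterexample_condition_def maj by (simp add: bl cong: conj_cong)
  obtain x0 where x0: "x0 \<in> carrier N" using N by (auto simp: is_struct_def)
  have "\<exists>G. realized (counterexample_condition N \<phi> n w k m) ?Fs G"
  proof (rule ex_realized[OF C Fs], rule ultra_mono[OF V bad])
    fix t :: "'k set" and s assume "\<not> ?good s"
    then obtain y where y: "y \<in> tuples w (carrier N)" "k \<le> card {b. b < m \<and>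
      sat_at N \<phi> (map (\<lambda>F. F s) (X (2 * k + b)) @ y) \<noteq> majority N \<phi> k (\<lambda>b. map (\<lambda>F. F s) (X b)) y}"
      by (meson not_le)
    \<comment> \<open>A single tuple is wanted, so the family is constant in
      \<open>j\<close>.\<close>
    define g where "g j i = (if i < w then y ! i else x0)" for j :: 'k and i
    have "map (g j) [0..<w] = y" for j using y(1) by (auto intro!: nth_equalityI simp: g_def
        tuples_def)
    hence "counterexample_condition N \<phi> n w k m (map (\<lambda>F. F s) ?Fs) t g" unfolding cc using y(2)
        by simp
    moreover have "\<forall>j i. g j i \<in> carrier N"
      using y(1) x0 unfolding g_def tuples_def by (auto simp: subset_iff)
    ultimately have "(\<forall>j i. g j i \<in> carrier N) \<and>
      counterexample_condition N \<phi> n w k m (map (\<lambda>F. F s) ?Fs) t g" by (rule conjI[rotated])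
    thus "\<exists>g. (\<forall>j i. g j i \<in> carrier N) \<and>
      counterexample_condition N \<phi> n w k m (map (\<lambda>F. F s) ?Fs) t g" by (rule exI[of _ g])
  qed
  then obtain G where Gr: "realized (counterexample_condition N \<phi> n w k m) ?Fs G" by blast
  note G = realized_in[OF Gr] and Gc = ae_realized[OF Gr]
  \<comment> \<open>The condition makes the same demand at every index, so any element of
    \<open>K\<close> yields the tuple.\<close>
  obtain j where j: "j \<in> K" using \<open>K \<noteq> {}\<close> by blast
  let ?Y = "map (G j) [0..<w]"
  have Y: "length ?Y = w" "set ?Y \<subseteq> H" using G[OF j] by auto
  have 1: "ae V (\<lambda>s. k \<le> card {b. b < m \<and> sat_at N \<phi> (map (\<lambda>F. F s) (X (2 * k + b)) @ map (\<lambda>F. F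
      s) ?Y) \<noteq>
       majority N \<phi> k (\<lambda>b. map (\<lambda>F. F s) (X b)) (map (\<lambda>F. F s) ?Y)})"
  proof (rule ultra_mono[OF V Gc])
    show "finite {j}" "{j} \<subseteq> K" using j by auto
    fix s assume "\<exists>t g. finite t \<and> {j} \<subseteq> t \<and>
       counterexample_condition N \<phi> n w k m (map (\<lambda>F. F s) ?Fs) t g \<and> (\<forall>j\<in>{j}. \<forall>i. G j i s = g j i)"
    then obtain t g where tg: "counterexample_condition N \<phi> n w k m (map (\<lambda>F. F s) ?Fs) t g"
      "\<forall>j\<in>{j}. \<forall>i. G j i s = g j i" by (elim exE conjE) (rule that)
    have "map (\<lambda>F. F s) ?Y = map (g j) [0..<w]" using tg(2) by simp
    thus "k \<le> card {b. b < m \<and> sat_at N \<phi> (map (\<lambda>F. F s) (X (2 * k + b)) @ map (\<lambda>F. F s) ?Y) \<noteq>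
       majority N \<phi> k (\<lambda>b. map (\<lambda>F. F s) (X b)) (map (\<lambda>F. F s) ?Y)}"
      using tg(1)[unfolded cc, rule_format, of j] by (simp only:)
  qed
  have 2: "ae V (\<lambda>s. majority N \<phi> k (\<lambda>b. map (\<lambda>F. F s) (X b)) (map (\<lambda>F. F s) ?Y) \<longleftrightarrow>
    majority prod \<phi> k (\<lambda>b. map \<pi> (X b)) (map \<pi> ?Y))"
    by (rule ae_majority[OF \<phi> _ Y]) (use X in auto)
  have 3: "ae V (\<lambda>s. \<forall>b\<in>{..<m}. sat_at N \<phi> (map (\<lambda>F. F s) (X (2 * k + b) @ ?Y)) \<longleftrightarrow>
     sat_at prod \<phi> (map \<pi> (X (2 * k + b) @ ?Y)))"
  proof (subst ultra_ball[OF V], simp, rule ballI, rule ae_los_at[OF \<phi>(1)])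
    fix b assume "b \<in> {..<m}"
    hence b: "2 * k + b < 2 * k + m" by simp
    show "set (X (2 * k + b) @ ?Y) \<subseteq> H" using X[OF b] Y(2) by simp
    show "fv \<phi> \<subseteq> {..<length (X (2 * k + b) @ ?Y)}" using X[OF b] Y(1) \<phi>(2) by simp
  qed
  from 1 2 3 have "ae V (\<lambda>s. k \<le> card {b. b < m \<and> sat_at N \<phi> (map (\<lambda>F. F s) (X (2 * k + b)) @ map
      (\<lambda>F. F s) ?Y) \<noteq>
       majority N \<phi> k (\<lambda>b. map (\<lambda>F. F s) (X b)) (map (\<lambda>F. F s) ?Y)} \<and>
     (majority N \<phi> k (\<lambda>b. map (\<lambda>F. F s) (X b)) (map (\<lambda>F. F s) ?Y) \<longleftrightarrow>
       majority prod \<phi> k (\<lambda>b. map \<pi> (X b)) (map \<pi> ?Y)) \<and>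
     (\<forall>b\<in>{..<m}. sat_at N \<phi> (map (\<lambda>F. F s) (X (2 * k + b) @ ?Y)) \<longleftrightarrow>
     sat_at prod \<phi> (map \<pi> (X (2 * k + b) @ ?Y))))" by (simp only: ultra_conj[OF V] simp_thms)
  from ultra_ex[OF V this] obtain s where
    s1: "k \<le> card {b. b < m \<and> sat_at N \<phi> (map (\<lambda>F. F s) (X (2 * k + b)) @ map (\<lambda>F. F s) ?Y) \<noteq>
       majority N \<phi> k (\<lambda>b. map (\<lambda>F. F s) (X b)) (map (\<lambda>F. F s) ?Y)}" and
    s2: "majority N \<phi> k (\<lambda>b. map (\<lambda>F. F s) (X b)) (map (\<lambda>F. F s) ?Y) \<longleftrightarrow>
       majority prod \<phi> k (\<lambda>b. map \<pi> (X b)) (map \<pi> ?Y)" and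
    s3: "\<forall>b\<in>{..<m}. sat_at N \<phi> (map (\<lambda>F. F s) (X (2 * k + b) @ ?Y)) \<longleftrightarrow>
     sat_at prod \<phi> (map \<pi> (X (2 * k + b) @ ?Y))" by (elim exE conjE)
  have "{b. b < m \<and> sat_at N \<phi> (map (\<lambda>F. F s) (X (2 * k + b)) @ map (\<lambda>F. F s) ?Y) \<noteq>
       majority N \<phi> k (\<lambda>b. map (\<lambda>F. F s) (X b)) (map (\<lambda>F. F s) ?Y)} =
     {b. b < m \<and> sat_at prod \<phi> (map \<pi> (X (2 * k + b)) @ map \<pi> ?Y) \<noteq>
       majority prod \<phi> k (\<lambda>b. map \<pi> (X b)) (map \<pi> ?Y)}"
    using s3 unfolding s2 map_append by blast
  moreover have "map \<pi> ?Y \<in> tuples w (carrier prod)" using G[OF j] \<pi>_carrier by (auto simp: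
      tuples_def)
  ultimately show False using s1 good[of "map \<pi> ?Y"] by simp
qed

text \<open>For finite \<open>t\<close>, a good sequence of length \<open>card t\<close> in
  \<open>prod\<close> is good at almost every \<open>s\<close> for all parameters from
  \<open>N\<close>, by \<open>ae_no_counterexample\<close>; this is the finite approximation. In the
  limit, a parameter with \<open>k\<close> errors would show them together at one
  \<open>s\<close>.\<close>

lemma approximating_sequence:
  assumes \<Phi>: "\<And>\<phi>. \<phi> \<in> set \<Phi> \<Longrightarrow> fm_in L \<phi> \<and> fv \<phi> \<subseteq> {..<n + w}"
    and C: "approximation_condition N \<Phi> n w k \<in> C"
      "\<And>\<phi> m. \<phi> \<in> set \<Phi> \<Longrightarrow> counterexample_condition N \<phi> n w k m \<in> C" and "K \<noteq> {}"
    and e: "\<And>b. b < 2 * k \<Longrightarrow> e b \<in> tuples n (carrier prod)"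
    and good: "\<And>m :: nat. \<exists>xs. (\<forall>b<m. xs b \<in> tuples n (carrier prod)) \<and> (\<forall>\<phi>\<in>set \<Phi>. \<forall>y\<in>tuples w
        (carrier prod).
      card {b. b < m \<and> sat_at prod \<phi> (xs b @ y) \<noteq> majority prod \<phi> k e y} < k)"
  shows "\<exists>c. (\<forall>j\<in>K. c j \<in> tuples n (carrier prod)) \<and> (\<forall>\<phi>\<in>set \<Phi>. \<forall>y\<in>tuples w (carrier prod).
      finite {j \<in> K. sat_at prod \<phi> (c j @ y) \<noteq> majority prod \<phi> k e y})"
proof -
  define E where "E b = map lift (e b)" for b
  have E: "set (E b) \<subseteq> H" "map \<pi> (E b) = e b" "length (E b) = n" if "b < 2 * k" for b
    using lift_tuple[OF e[OF that]] by (simp_all add: E_def)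
  let ?Fs = "flatten n E (2 * k)"
  have Fs: "set ?Fs \<subseteq> H" by (rule set_flatten) (use E in simp)
  have bl: "block n (map (\<lambda>F. F s) ?Fs) b = map (\<lambda>F. F s) (E b)" if "b < 2 * k" for b s
    by (rule block_flatten[of b "2 * k" E n, OF that E(3)[OF that]])
  have maj: "majority N \<phi> k (block n (map (\<lambda>F. F s) ?Fs)) y = majority N \<phi> k (\<lambda>b. map (\<lambda>F. F s) (E
      b)) y" for s y \<phi>
    by (rule majority_cong) (simp add: bl)
  obtain x0 where x0: "x0 \<in> carrier N" using N by (auto simp: is_struct_def)
  have "\<exists>G. realized (approximation_condition N \<Phi> n w k) ?Fs G"
  proof (rule ex_realized[OF C(1) Fs])
    fix t :: "'k set" assume t: "finite t"
    let ?m = "card t"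
    obtain idx where idx: "bij_betw idx t {..<?m}"
      using ex_bij_betw_finite_nat[OF t] by (auto simp: atLeast0LessThan)
    obtain xs where xs: "\<And>b. b < ?m \<Longrightarrow> xs b \<in> tuples n (carrier prod)" "\<And>\<phi> y. \<phi> \<in> set \<Phi> \<Longrightarrow>
      y \<in> tuples w (carrier prod) \<Longrightarrow> card {b. b < ?m \<and> sat_at prod \<phi> (xs b @ y) \<noteq> majority prod \<phi> k
          e y} < k"
      using good[of ?m] by blast
    \<comment> \<open>The voters come first and the sequence follows, the layout that
      \<open>counterexample_condition\<close> reads.\<close>
    define X where "X b = (if b < 2 * k then E b else map lift (xs (b - 2 * k)))" for b
    have X: "length (X b) = n \<and> set (X b) \<subseteq> H" if "b < 2 * k + ?m" for b
    proof (cases "b < 2 * k")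
      case False
      hence "b - 2 * k < ?m" using that by simp
      from lift_tuple[OF xs(1)[OF this]] False show ?thesis by (simp add: X_def)
    qed (use E in \<open>simp add: X_def\<close>)
    have majX: "majority prod \<phi> k (\<lambda>b. map \<pi> (X b)) y = majority prod \<phi> k e y" for \<phi> y
      by (rule majority_cong) (simp add: X_def E)
    have majX': "majority N \<phi> k (\<lambda>b. map (\<lambda>F. F s) (X b)) y = majority N \<phi> k (\<lambda>b. map (\<lambda>F. F s) (E
        b)) y" for \<phi> y s
      by (rule majority_cong) (simp add: X_def)
    have Xxs: "map \<pi> (X (2 * k + b)) = xs b" if "b < ?m" for b
      using lift_tuple[OF xs(1)[OF that]] by (simp add: X_def)
    have "ae V (\<lambda>s. \<forall>\<phi>\<in>set \<Phi>. \<forall>y\<in>tuples w (carrier N).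
      card {b. b < ?m \<and> sat_at N \<phi> (map (\<lambda>F. F s) (X (2 * k + b)) @ y) \<noteq>
        majority N \<phi> k (\<lambda>b. map (\<lambda>F. F s) (X b)) y} < k)"
    proof (subst ultra_ball[OF V], simp, rule ballI)
      fix \<phi> assume \<phi>: "\<phi> \<in> set \<Phi>"
      show "ae V (\<lambda>s. \<forall>y\<in>tuples w (carrier N).
        card {b. b < ?m \<and> sat_at N \<phi> (map (\<lambda>F. F s) (X (2 * k + b)) @ y) \<noteq>
          majority N \<phi> k (\<lambda>b. map (\<lambda>F. F s) (X b)) y} < k)"
      proof (rule ae_no_counterexample[OF _ _ C(2)[OF \<phi>] \<open>K \<noteq> {}\<close> X])
        fix y assume y: "y \<in> tuples w (carrier prod)"
        have "{b. b < ?m \<and> sat_at prod \<phi> (map \<pi> (X (2 * k + b)) @ y) \<noteq> majority prod \<phi> k e y} =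
          {b. b < ?m \<and> sat_at prod \<phi> (xs b @ y) \<noteq> majority prod \<phi> k e y}" using Xxs by auto
        thus "card {b. b < ?m \<and> sat_at prod \<phi> (map \<pi> (X (2 * k + b)) @ y) \<noteq>
          majority prod \<phi> k (\<lambda>b. map \<pi> (X b)) y} < k" using xs(2)[OF \<phi> y] by (simp only: majX)
      qed (use \<Phi>[OF \<phi>] in simp_all)
    qed
    thus "ae V (\<lambda>s. \<exists>g. (\<forall>j i. g j i \<in> carrier N) \<and> approximation_condition N \<Phi> n w k (map (\<lambda>F. F
        s) ?Fs) t g)"
    proof (rule ultra_mono[OF V])
      fix s assume s: "\<forall>\<phi>\<in>set \<Phi>. \<forall>y\<in>tuples w (carrier N).
        card {b. b < ?m \<and> sat_at N \<phi> (map (\<lambda>F. F s) (X (2 * k + b)) @ y) \<noteq>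
          majority N \<phi> k (\<lambda>b. map (\<lambda>F. F s) (X b)) y} < k"
      \<comment> \<open>The point \<open>j\<close> of \<open>t\<close> receives the tuple at
        position \<open>idx j\<close>; errors at points of \<open>t\<close> thus inject into errors
        at positions.\<close>
      define g where "g j i = (if j \<in> t \<and> i < n then (X (2 * k + idx j) ! i) s else x0)" for j ::
          'k and i :: nat
      have idxm: "idx j < ?m" if "j \<in> t" for j using bij_betwE[OF idx] that by auto
      have gX: "map (g j) [0..<n] = map (\<lambda>F. F s) (X (2 * k + idx j))" if "j \<in> t" for j
        using that X[of "2 * k + idx j"] idxm[OF that] by (auto intro!: nth_equalityI simp: g_def)
      have "g j i \<in> carrier N" for j i
      proof (cases "j \<in> t \<and> i < n")
        case True
        hence "X (2 * k + idx j) ! i \<in> H" using X[of "2 * k + idx j"] idxm[of j] nth_mem[of i "X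
            (2 * k + idx j)"] by auto
        with True show ?thesis by (simp add: g_def H_carrier)
      qed (use x0 in \<open>auto simp: g_def\<close>)
      moreover have "approximation_condition N \<Phi> n w k (map (\<lambda>F. F s) ?Fs) t g"
        unfolding approximation_condition_def
      proof (intro ballI)
        fix \<phi> y assume \<phi>: "\<phi> \<in> set \<Phi>" and y: "y \<in> tuples w (carrier N)"
        let ?A = "{j \<in> t. sat_at N \<phi> (map (g j) [0..<n] @ y) \<noteq> majority N \<phi> k (block n (map (\<lambda>F. F
            s) ?Fs)) y}"
        let ?B = "{b. b < ?m \<and> sat_at N \<phi> (map (\<lambda>F. F s) (X (2 * k + b)) @ y) \<noteq>
          majority N \<phi> k (\<lambda>b. map (\<lambda>F. F s) (X b)) y}"
        have "idx ` ?A \<subseteq> ?B" using gX idxm by (auto simp: maj majX')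
        moreover have "inj_on idx ?A" using idx by (auto simp: bij_betw_def inj_on_def)
        ultimately have "card ?A \<le> card ?B" by (intro card_inj_on_le[of idx]) auto
        thus "card ?A < k" using s \<phi> y by (meson le_less_trans)
      qed
      ultimately have "(\<forall>j i. g j i \<in> carrier N) \<and> approximation_condition N \<Phi> n w k (map (\<lambda>F. F
          s) ?Fs) t g"
        by simp
      thus "\<exists>g. (\<forall>j i. g j i \<in> carrier N) \<and> approximation_condition N \<Phi> n w k (map (\<lambda>F. F s) ?Fs)
          t g"
        by (rule exI[of _ g])
    qed
  qed
  then obtain G where Gr: "realized (approximation_condition N \<Phi> n w k) ?Fs G" by blast
  note G = realized_in[OF Gr]
  define c where "c j = map \<pi> (map (G j) [0..<n])" for j
  have "finite {j \<in> K. sat_at prod \<phi> (c j @ y) \<noteq> majority prod \<phi> k e y}" (is "finite ?Bad")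
    if \<phi>: "\<phi> \<in> set \<Phi>" and y: "y \<in> tuples w (carrier prod)" for \<phi> y
  proof (rule ccontr)
    assume "infinite ?Bad"
    \<comment> \<open>A set of \<open>k\<close> errors suffices: at some \<open>s\<close> all of
      them lie in one \<open>t\<close>, where the condition allows fewer than
      \<open>k\<close>.\<close>
    then obtain J where J: "finite J" "card J = k" "J \<subseteq> ?Bad" using infinite_arbitrarily_large by
        blast
    have JK: "J \<subseteq> K" using J(3) by auto
    let ?Y = "map lift y"
    note Y = lift_tuple[OF y]
    have 1: "ae V (\<lambda>s. majority N \<phi> k (\<lambda>b. map (\<lambda>F. F s) (E b)) (map (\<lambda>F. F s) ?Y) \<longleftrightarrow>
      majority prod \<phi> k (\<lambda>b. map \<pi> (E b)) (map \<pi> ?Y))"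
      by (rule ae_majority[OF _ _ _ Y(3,1)]) (use \<Phi>[OF \<phi>] E in auto)
    have 2: "ae V (\<lambda>s. \<forall>j\<in>J. sat_at N \<phi> (map (\<lambda>F. F s) (map (G j) [0..<n] @ ?Y)) \<longleftrightarrow>
      sat_at prod \<phi> (map \<pi> (map (G j) [0..<n] @ ?Y)))"
      by (subst ultra_ball[OF V J(1)], rule ballI, rule ae_los_at) (use \<Phi>[OF \<phi>] G JK Y in auto)
    from 1 2 ae_realized[OF Gr J(1) JK]
    have "ae V (\<lambda>s. (majority N \<phi> k (\<lambda>b. map (\<lambda>F. F s) (E b)) (map (\<lambda>F. F s) ?Y) \<longleftrightarrow>
        majority prod \<phi> k (\<lambda>b. map \<pi> (E b)) (map \<pi> ?Y)) \<and>
      (\<forall>j\<in>J. sat_at N \<phi> (map (\<lambda>F. F s) (map (G j) [0..<n] @ ?Y)) \<longleftrightarrow>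
        sat_at prod \<phi> (map \<pi> (map (G j) [0..<n] @ ?Y))) \<and>
      (\<exists>t g. finite t \<and> J \<subseteq> t \<and> approximation_condition N \<Phi> n w k (map (\<lambda>F. F s) ?Fs) t g \<and>
        (\<forall>j\<in>J. \<forall>i. G j i s = g j i)))" by (simp only: ultra_conj[OF V] simp_thms)
    from ultra_ex[OF V this] obtain s t g where
      s1: "majority N \<phi> k (\<lambda>b. map (\<lambda>F. F s) (E b)) (map (\<lambda>F. F s) ?Y) \<longleftrightarrow>
        majority prod \<phi> k (\<lambda>b. map \<pi> (E b)) (map \<pi> ?Y)" and
      s2: "\<forall>j\<in>J. sat_at N \<phi> (map (\<lambda>F. F s) (map (G j) [0..<n] @ ?Y)) \<longleftrightarrow>
        sat_at prod \<phi> (map \<pi> (map (G j) [0..<n] @ ?Y))" and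
      t: "finite t" "J \<subseteq> t" and s3: "approximation_condition N \<Phi> n w k (map (\<lambda>F. F s) ?Fs) t g" and
      s4: "\<forall>j\<in>J. \<forall>i. G j i s = g j i" by (elim exE conjE) (rule that)
    let ?y = "map (\<lambda>F. F s) ?Y"
    have "?y \<in> tuples w (carrier N)" using Y(1,3) H_carrier by (auto simp: tuples_def)
    hence less: "card {j \<in> t. sat_at N \<phi> (map (g j) [0..<n] @ ?y) \<noteq> majority N \<phi> k (\<lambda>b. map (\<lambda>F. F
        s) (E b)) ?y} < k"
      using s3 \<phi> unfolding approximation_condition_def maj by blast
    have "majority prod \<phi> k (\<lambda>b. map \<pi> (E b)) (map \<pi> ?Y) \<longleftrightarrow> majority prod \<phi> k e y"
      unfolding Y(2) by (rule majority_cong) (simp add: E)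
    hence s1': "majority N \<phi> k (\<lambda>b. map (\<lambda>F. F s) (E b)) ?y \<longleftrightarrow> majority prod \<phi> k e y" using s1 by
        simp
    have "sat_at N \<phi> (map (g j) [0..<n] @ ?y) \<longleftrightarrow> sat_at prod \<phi> (c j @ y)" if "j \<in> J" for j
    proof -
      have "map (\<lambda>F. F s) (map (G j) [0..<n] @ ?Y) = map (g j) [0..<n] @ ?y" using s4 that by simp
      moreover have "map \<pi> (map (G j) [0..<n] @ ?Y) = c j @ y" using Y(2) by (simp add: c_def)
      ultimately show ?thesis using s2 that by (metis (no_types))
    qed
    hence "J \<subseteq> {j \<in> t. sat_at N \<phi> (map (g j) [0..<n] @ ?y) \<noteq> majority N \<phi> k (\<lambda>b. map (\<lambda>F. F s) (E
        b)) ?y}"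
      using J(3) t(2) unfolding s1' by auto
    from card_mono[OF _ this] less t(1) J(2) show False by simp
  qed
  moreover have "c j \<in> tuples n (carrier prod)" if "j \<in> K" for j
    using G[OF that] \<pi>_carrier by (auto simp: c_def tuples_def)
  ultimately show ?thesis by (intro exI[of _ c]) blast
qed

end

section \<open>Infinite models\<close>

lemma sat_Exs:
  "sat M e ((Ex ^^ n) \<phi>) \<longleftrightarrow>
     (\<exists>xs\<in>tuples n (carrier M). sat M (\<lambda>i. if i < n then xs ! i else e (i - n)) \<phi>)"
proof (induct n arbitrary: e)
  case 0
  then show ?case by (simp add: tuples_def)
next
  case (Suc n)
  \<comment> \<open>The outermost of the quantifiers binds index \<open>n\<close>, so its element
    goes to the end of \<open>xs\<close>.\<close>
  have env: "(\<lambda>i. if i < n then xs ! i else case_nat a e (i - n)) =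
      (\<lambda>i. if i < Suc n then (xs @ [a]) ! i else e (i - Suc n))" if "length xs = n" for a xs
  proof
    fix i
    consider "i < n" | "i = n" | "i - n = Suc (i - Suc n)" "i > n" by linarith
    thus "(if i < n then xs ! i else case_nat a e (i - n)) =
        (if i < Suc n then (xs @ [a]) ! i else e (i - Suc n))"
      using that by cases (auto simp: nth_append)
  qed
  have "sat M e ((Ex ^^ Suc n) \<phi>) \<longleftrightarrow> (\<exists>a\<in>carrier M. \<exists>xs\<in>tuples n (carrier M).
      sat M (\<lambda>i. if i < n then xs ! i else case_nat a e (i - n)) \<phi>)" by (simp add: Suc)
  also have "\<dots> \<longleftrightarrow> (\<exists>a\<in>carrier M. \<exists>xs\<in>tuples n (carrier M).
      sat M (\<lambda>i. if i < Suc n then (xs @ [a]) ! i else e (i - Suc n)) \<phi>)"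
    by (intro bex_cong refl) (simp add: env tuples_def)
  also have "\<dots> \<longleftrightarrow> (\<exists>xs\<in>tuples (Suc n) (carrier M).
      sat M (\<lambda>i. if i < Suc n then xs ! i else e (i - Suc n)) \<phi>)"
  proof
    assume "\<exists>a\<in>carrier M. \<exists>xs\<in>tuples n (carrier M).
      sat M (\<lambda>i. if i < Suc n then (xs @ [a]) ! i else e (i - Suc n)) \<phi>"
    then obtain a xs where "a \<in> carrier M" "xs \<in> tuples n (carrier M)"
      and s: "sat M (\<lambda>i. if i < Suc n then (xs @ [a]) ! i else e (i - Suc n)) \<phi>" by blast
    hence "xs @ [a] \<in> tuples (Suc n) (carrier M)" by (simp add: tuples_def)
    with s show "\<exists>xs\<in>tuples (Suc n) (carrier M).
      sat M (\<lambda>i. if i < Suc n then xs ! i else e (i - Suc n)) \<phi>" by blast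
  next
    assume "\<exists>xs\<in>tuples (Suc n) (carrier M). sat M (\<lambda>i. if i < Suc n then xs ! i else e (i - Suc
        n)) \<phi>"
    then obtain xs where xs: "xs \<in> tuples (Suc n) (carrier M)"
      and s: "sat M (\<lambda>i. if i < Suc n then xs ! i else e (i - Suc n)) \<phi>" by blast
    have "xs \<noteq> []" using xs by (auto simp: tuples_def)
    then obtain ys a where "xs = ys @ [a]" by (metis append_butlast_last_id)
    with xs s show "\<exists>a\<in>carrier M. \<exists>xs\<in>tuples n (carrier M).
      sat M (\<lambda>i. if i < Suc n then (xs @ [a]) ! i else e (i - Suc n)) \<phi>" by (auto simp: tuples_def)
  qed
  finally show ?case .
qed

lemma fv_Exs: "fv ((Ex ^^ n) \<phi>) = {i. i + n \<in> fv \<phi>}"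
  by (induct n) auto

lemma fm_in_Exs: "fm_in L ((Ex ^^ n) \<phi>) \<longleftrightarrow> fm_in L \<phi>"
  by (induct n) auto

definition distinct_fm :: "nat \<Rightarrow> ('f, 'r) fm" where
  "distinct_fm n = foldr And [Neg (Eq (Var i) (Var j)). i \<leftarrow> [0..<n], j \<leftarrow> [0..<i]] (Neg Bot)"

lemma sat_foldr_And: "sat M e (foldr And \<phi>s (Neg Bot)) \<longleftrightarrow> (\<forall>\<phi>\<in>set \<phi>s. sat M e \<phi>)"
  by (induct \<phi>s) auto

lemma fv_foldr_And: "fv (foldr And \<phi>s (Neg Bot)) = (\<Union>\<phi>\<in>set \<phi>s. fv \<phi>)"
  by (induct \<phi>s) auto

lemma fm_in_foldr_And: "fm_in L (foldr And \<phi>s (Neg Bot)) \<longleftrightarrow> (\<forall>\<phi>\<in>set \<phi>s. fm_in L \<phi>)"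
  by (induct \<phi>s) auto

lemma at_least_sentence: "(Ex ^^ n) (distinct_fm n) \<in> sentences L"
proof -
  have "fv (distinct_fm n :: ('a, 'b) fm) \<subseteq> {..<n}"
    unfolding distinct_fm_def fv_foldr_And by auto
  hence "i + n \<notin> fv (distinct_fm n :: ('a, 'b) fm)" for i by auto
  moreover have "fm_in L (distinct_fm n)" unfolding distinct_fm_def fm_in_foldr_And by auto
  ultimately show ?thesis by (simp add: sentences_def formulas_def fv_Exs fm_in_Exs)
qed

lemma sat_at_least:
  "sat_at M ((Ex ^^ n) (distinct_fm n)) [] \<longleftrightarrow> (\<exists>xs\<in>tuples n (carrier M). distinct xs)"
proof -
  have "sat M (\<lambda>i. if i < n then xs ! i else [] ! (i - n)) (distinct_fm n) \<longleftrightarrow> distinct xs"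
    if "length xs = n" for xs
  proof -
    have "sat M (\<lambda>i. if i < n then xs ! i else [] ! (i - n)) (distinct_fm n) \<longleftrightarrow>
        (\<forall>i<n. \<forall>j<i. xs ! i \<noteq> xs ! j)"
      unfolding distinct_fm_def sat_foldr_And by auto
    also have "\<dots> \<longleftrightarrow> distinct xs"
      using that by (auto simp: distinct_conv_nth) (metis linorder_neqE_nat)
    finally show ?thesis .
  qed
  thus ?thesis unfolding sat_at_def sat_Exs by (auto simp: tuples_def)
qed

text \<open>Having at least a given finite number of elements is expressed by a sentence, which a
  complete theory decides in the same way for all its models.\<close>

lemma infinite_models:
  fixes T :: "('f, 'r) fm set"
  assumes "complete_theory TYPE('u) L T" and M0: "M0 \<in> (Mod L T :: ('f, 'r, 'u) struct set)"
      "infinite (carrier M0)"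
    and M: "M \<in> (Mod L T :: ('f, 'r, 'u) struct set)"
  shows "infinite (carrier M)"
proof
  assume fin: "finite (carrier M)"
  let ?n = "Suc (card (carrier M))"
  let ?\<phi> = "(Ex ^^ ?n) (distinct_fm ?n) :: ('f, 'r) fm"
  obtain S where "S \<subseteq> carrier M0" "finite S" "card S = ?n"
    using infinite_arbitrarily_large[OF M0(2)] by blast
  moreover from this obtain xs where "set xs = S" "distinct xs" using finite_distinct_list by blast
  ultimately have "sat_at M0 ?\<phi> []" unfolding sat_at_least using distinct_card[of xs] by (auto
      simp: tuples_def)
  hence "\<not> sat_at M0 (Neg ?\<phi>) []" by (simp add: sat_at_def)
  hence "sat_at M ?\<phi> []"
    using assms(1) at_least_sentence[of ?n L] M0(1) M unfolding complete_theory_def by blast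
  then obtain xs where "length xs = ?n" "set xs \<subseteq> carrier M" "distinct xs"
    unfolding sat_at_least by (auto simp: tuples_def)
  moreover from this have "card (set xs) \<le> card (carrier M)" by (intro card_mono[OF fin])
  ultimately show False using distinct_card[of xs] by simp
qed

section \<open>Realizing local types\<close>

text \<open>A variable of \<open>\<delta>\<close> that is not mapped to one of the first \<open>n\<close> variables is sent to a parameter
  of its own, so that finitely many formulas serve for all substitutions.\<close>

definition pattern :: "nat \<Rightarrow> nat list \<Rightarrow> nat \<Rightarrow> nat" where
  "pattern n \<tau> v = (if \<tau> ! v < n then \<tau> ! v else n + v)"

text \<open>The list \<open>\<tau>\<close> records which of the first \<open>n\<close> variables
  each variable below \<open>w\<close> becomes; the entry \<open>n\<close> marks a
  parameter.\<close>

definition patterns :: "nat \<Rightarrow> nat \<Rightarrow> ('f, 'r) fm list \<Rightarrow> ('f, 'r) fm list" where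
  "patterns n w ds = [rename (pattern n \<tau>) \<delta>. \<delta> \<leftarrow> ds, \<tau> \<leftarrow> List.n_lists w [0..<Suc n]]"

lemma patterns:
  assumes "\<And>\<delta>. \<delta> \<in> set ds \<Longrightarrow> fm_in L \<delta> \<and> fv \<delta> \<subseteq> {..<w}" "\<phi> \<in> set (patterns n w ds)"
  shows "fm_in L \<phi> \<and> fv \<phi> \<subseteq> {..<n + w}"
proof -
  obtain \<delta> \<tau> where d: "\<delta> \<in> set ds" "\<phi> = rename (pattern n \<tau>) \<delta>"
    using assms(2) by (auto simp: patterns_def)
  have "pattern n \<tau> v < n + w" if "v < w" for v using that by (simp add: pattern_def)
  thus ?thesis using assms(1)[OF d(1)] unfolding d(2) fm_in_rename fv_rename by auto
qed

text \<open>Identifications with the first \<open>n\<close> variables are kept in the pattern, while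
  identifications among parameters become repeated entries of \<open>y\<close>.\<close>

lemma sat_pattern:
  assumes \<delta>: "\<delta> \<in> set ds" "fv \<delta> \<subseteq> {..<w}" and \<sigma>: "\<sigma> ` fv \<delta> \<subseteq> {..<n + length as}" and as: "set as \<subseteq>
      A" "a0 \<in> A"
  shows "\<exists>\<phi>\<in>set (patterns n w ds). \<exists>y\<in>tuples w A. \<forall>c. length c = n \<longrightarrow>
    (sat M (\<lambda>v. (c @ as) ! \<sigma> v) \<delta> \<longleftrightarrow> sat_at M \<phi> (c @ y))"
proof -
  define \<tau> where "\<tau> = map (\<lambda>v. if \<sigma> v < n then \<sigma> v else n) [0..<w]"
  \<comment> \<open>\<open>a0\<close> fills the places that no entry of \<open>as\<close>
    claims.\<close>
  define y where "y = map (\<lambda>v. if n \<le> \<sigma> v \<and> \<sigma> v < n + length as then as ! (\<sigma> v - n) else a0)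
      [0..<w]"
  have "\<tau> \<in> set (List.n_lists w [0..<Suc n])" by (auto simp: set_n_lists \<tau>_def)
  hence "rename (pattern n \<tau>) \<delta> \<in> set (patterns n w ds)" using \<delta>(1) by (auto simp: patterns_def)
  moreover have "y \<in> tuples w A"
  proof -
    have "as ! i \<in> A" if "i < length as" for i using as(1) that nth_mem by blast
    thus ?thesis using as(2) by (auto simp: y_def tuples_def)
  qed
  moreover have "sat M (\<lambda>v. (c @ as) ! \<sigma> v) \<delta> \<longleftrightarrow> sat_at M (rename (pattern n \<tau>) \<delta>) (c @ y)" if
      "length c = n" for c
    unfolding sat_at_def sat_rename
  proof (rule sat_cong)
    fix v assume v: "v \<in> fv \<delta>"
    hence "v < w" "\<sigma> v < n + length as" using \<delta>(2) \<sigma> by auto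
    thus "(c @ as) ! \<sigma> v = ((\<lambda>i. (c @ y) ! i) \<circ> pattern n \<tau>) v"
      using that by (auto simp: pattern_def \<tau>_def y_def nth_append)
  qed
  ultimately show ?thesis by blast
qed

text \<open>Both sides commute with Boolean connectives, so only generators matter, and an instance
  of a generator is a pattern.\<close>

lemma sat_instance_iff_ae:
  assumes D: "ultra D" "ae D (\<lambda>x. length x = n)" and c: "length c = n"
    and \<Delta>: "\<And>\<delta>. \<delta> \<in> set ds \<Longrightarrow> fv \<delta> \<subseteq> {..<w}" and as: "set as \<subseteq> A" "a0 \<in> A"
    and agree: "\<And>\<phi> y. \<phi> \<in> set (patterns n w ds) \<Longrightarrow> y \<in> tuples w A \<Longrightarrow>
      sat_at M \<phi> (c @ y) \<longleftrightarrow> ae D (\<lambda>x. sat_at M \<phi> (x @ y))"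
    and \<theta>: "\<theta> \<in> bool_alg (set ds)" "\<sigma> ` fv \<theta> \<subseteq> {..<n + length as}"
  shows "sat M (\<lambda>v. (c @ as) ! \<sigma> v) \<theta> \<longleftrightarrow> ae D (\<lambda>x. sat M (\<lambda>v. (x @ as) ! \<sigma> v) \<theta>)"
  using \<theta>
proof (induct rule: bool_alg.induct)
  case (gen \<delta>)
  obtain \<phi> y where \<phi>: "\<phi> \<in> set (patterns n w ds)" "y \<in> tuples w A" "\<And>c. length c = n \<Longrightarrow>
    sat M (\<lambda>v. (c @ as) ! \<sigma> v) \<delta> \<longleftrightarrow> sat_at M \<phi> (c @ y)"
    using sat_pattern[OF gen(1) \<Delta>[OF gen(1)] gen(2) as, of M] by blast
  have "ae D (\<lambda>x. sat M (\<lambda>v. (x @ as) ! \<sigma> v) \<delta> \<longleftrightarrow> sat_at M \<phi> (x @ y))"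
    by (rule ultra_mono[OF D]) (rule \<phi>(3))
  from ultra_cong_ae[OF D(1) this] show ?case using \<phi>(3)[OF c] agree[OF \<phi>(1,2)] by simp
next
  case bot
  then show ?case by (simp add: ultra_const[OF D(1)])
next
  case (neg \<theta>)
  then show ?case by (simp add: ultra_not[OF D(1)])
next
  case (conj \<theta> \<theta>')
  then show ?case by (simp add: ultra_conj[OF D(1)] image_Un)
qed

section \<open>Counting parameters and errors\<close>

lemma card_of_finite_ordLess: "finite A \<Longrightarrow> infinite B \<Longrightarrow> |A| <o |B|"
  by (rule finite_ordLess_infinite) (simp_all add: Field_card_of card_of_well_order_on)

text \<open>A union of finite sets over an infinite \<open>I\<close> has size at most that of
  \<open>I\<close>, and over a finite \<open>I\<close> it is finite. In both cases it is smaller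
  than \<open>K\<close>, be \<open>K\<close> regular or singular.\<close>

lemma ex_outside_finite_sets:
  fixes K :: "'k set"
  assumes K: "infinite K" and I: "|I| <o |K|" and fin: "\<And>i. i \<in> I \<Longrightarrow> finite (B i)"
  shows "\<exists>j\<in>K. \<forall>i\<in>I. j \<notin> B i"
proof -
  have "|\<Union>i\<in>I. B i| <o |K|"
  proof (cases "finite I")
    case True
    hence "finite (\<Union>i\<in>I. B i)" using fin by blast
    thus ?thesis using K by (simp add: card_of_finite_ordLess)
  next
    case False
    have "|\<Union>i\<in>I. B i| \<le>o |I|"
    proof (rule card_of_UNION_ordLeq_infinite[OF False])
      show "|I| \<le>o |I|" by (rule card_of_mono1[OF subset_refl])
      show "\<forall>i\<in>I. |B i| \<le>o |I|" using fin False by (simp add: card_of_finite_ordLess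
          ordLess_imp_ordLeq)
    qed
    thus ?thesis using I ordLeq_ordLess_trans by blast
  qed
  hence "\<not> K \<subseteq> (\<Union>i\<in>I. B i)" using card_of_mono1 not_ordLess_ordLeq by blast
  thus ?thesis by blast
qed

lemma card_of_tuples_ordLess:
  assumes K: "infinite K" and A: "|A| <o |K|" and \<Phi>: "finite \<Phi>"
  shows "|\<Phi> \<times> tuples w A| <o |K|"
proof (cases "finite A")
  case True
  have "tuples w A = {xs. set xs \<subseteq> A \<and> length xs = w}" by (auto simp: tuples_def)
  hence "finite (\<Phi> \<times> tuples w A)" using \<Phi> finite_lists_length_eq[OF True, of w] by simp
  thus ?thesis using K by (simp add: card_of_finite_ordLess)
next
  case False
  have "tuples w A \<subseteq> lists A" by (auto simp: tuples_def)
  hence "|tuples w A| \<le>o |A|"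
    using card_of_lists_ordLeq_infinite[OF False card_of_mono1[OF subset_refl]] card_of_mono1
        ordLeq_transitive by blast
  moreover have "|\<Phi>| \<le>o |A|" using \<Phi> False by (simp add: card_of_finite_ordLess ordLess_imp_ordLeq)
  ultimately have "|\<Phi> \<times> tuples w A| \<le>o |A|" by (intro card_of_Times_ordLeq[OF False])
  thus ?thesis using A ordLeq_ordLess_trans by blast
qed

lemma card_of_insert_ordLess:
  assumes K: "infinite K" and A: "|A| <o |K|"
  shows "|insert a A| <o |K|"
proof -
  have "|{a} \<union> A| <o |K|"
    by (rule card_of_Un_ordLess_infinite[OF K _ A]) (simp add: K card_of_finite_ordLess)
  thus ?thesis by simp
qed

lemma half_graph_mono:
  assumes "half_graph M \<phi> n w h" "h' \<le> h"
  shows "half_graph M \<phi> n w h'"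
proof -
  obtain xs ys where xs: "\<forall>i<h. xs i \<in> tuples n (carrier M) \<and> ys i \<in> tuples w (carrier M)"
    "\<forall>i<h. \<forall>j<h. sat_at M \<phi> (xs i @ ys j) \<longleftrightarrow> i < j"
    using assms(1) unfolding half_graph_def by (elim exE conjE)
  show ?thesis unfolding half_graph_def
    by (rule exI[of _ xs], rule exI[of _ ys]) (use xs assms(2) in auto)
qed

lemma majority_of_few_errors:
  assumes "card {b. b < 2 * k \<and> P b \<noteq> v} < k"
  shows "k \<le> card {b. b < 2 * k \<and> P b} \<longleftrightarrow> v"
proof (cases v)
  case True
  have "{..<2 * k} = {b. b < 2 * k \<and> P b} \<union> {b. b < 2 * k \<and> P b \<noteq> v}" using True by auto
  hence "2 * k \<le> card {b. b < 2 * k \<and> P b} + card {b. b < 2 * k \<and> P b \<noteq> v}"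
    by (metis card_Un_le card_lessThan)
  with assms True show ?thesis by simp
next
  case False
  with assms show ?thesis by simp
qed

section \<open>Realizing a local type in the ultraproduct\<close>

context rich_ultraproduct
begin

text \<open>The values given by an ultrafilter extending the type become majority votes on finitely
  many tuples, and a sequence indexed by \<open>K\<close> follows these votes with finitely many
  errors for each parameter. Too few parameters are involved to spoil every member of the
  sequence.\<close>

lemma prod_realizes_local_type:
  assumes K: "infinite K" and L0: "sublanguage L0 L"
    and stable: "\<And>\<phi> n w. \<phi> \<in> formulas L0 \<Longrightarrow> fv \<phi> \<subseteq> {..<n + w} \<Longrightarrow> \<exists>h. \<not> half_graph prod \<phi> n w h"
    and C: "\<And>\<Phi> n w k. set \<Phi> \<subseteq> formulas L0 \<Longrightarrow> approximation_condition N \<Phi> n w k \<in> C"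
      "\<And>\<phi> n w k m. \<phi> \<in> formulas L0 \<Longrightarrow> counterexample_condition N \<phi> n w k m \<in> C"
    and \<Delta>: "finite \<Delta>" "\<Delta> \<subseteq> formulas L0" and A: "A \<subseteq> carrier prod" "|A| <o |K|"
    and p: "is_local_type prod \<Delta> n A p"
  shows "\<exists>c. realizes prod n c p"
proof -
  obtain ds where ds: "set ds = \<Delta>" using finite_list[OF \<Delta>(1)] by blast
  obtain w where w: "\<And>\<delta>. \<delta> \<in> set ds \<Longrightarrow> fv \<delta> \<subseteq> {..<w}"
  proof -
    have "finite (\<Union>\<delta>\<in>set ds. fv \<delta>)" by (simp add: finite_fv)
    then obtain b where "\<forall>i\<in>(\<Union>\<delta>\<in>set ds. fv \<delta>). i \<le> b" using finite_nat_set_iff_bounded_le by blast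
    thus ?thesis by (intro that[of "Suc b"]) (auto simp: less_Suc_eq_le)
  qed
  define \<Phi> where "\<Phi> = patterns n w ds"
  have \<Phi>: "fm_in L0 \<phi> \<and> fv \<phi> \<subseteq> {..<n + w}" if "\<phi> \<in> set \<Phi>" for \<phi>
    by (rule patterns[OF _ that[unfolded \<Phi>_def]]) (use w \<Delta>(2) ds in \<open>auto simp: formulas_def\<close>)
  hence \<Phi>L: "fm_in L \<phi> \<and> fv \<phi> \<subseteq> {..<n + w}" if "\<phi> \<in> set \<Phi>" for \<phi> using that fm_in_mono[OF L0] by
      blast
  \<comment> \<open>The index \<open>None\<close> makes \<open>D\<close> concentrate on tuples of
    the carrier even if \<open>p\<close> is empty.\<close>
  have "\<exists>D. ultra D \<and> (\<forall>q\<in>insert None (Some ` p). ae D (\<lambda>x. x \<in> tuples n (carrier prod) \<and>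
      (case q of None \<Rightarrow> True | Some (\<psi>, as) \<Rightarrow> sat_at prod \<psi> (x @ as))))"
  proof (rule ultra_ex_of_fip)
    fix J assume J: "finite J" "J \<subseteq> insert None (Some ` p)"
    have "{q. Some q \<in> J} = Some -` J" by auto
    hence "finite {q. Some q \<in> J}" using finite_vimageI[OF J(1), of Some] by simp
    moreover have "{q. Some q \<in> J} \<subseteq> p" using J(2) by auto
    ultimately obtain x where "realizes prod n x {q. Some q \<in> J}"
      using p unfolding is_local_type_def consistent_in_def by blast
    thus "\<exists>x. \<forall>q\<in>J. x \<in> tuples n (carrier prod) \<and>
      (case q of None \<Rightarrow> True | Some (\<psi>, as) \<Rightarrow> sat_at prod \<psi> (x @ as))"
      by (intro exI[of _ x]) (auto simp: realizes_def split: option.splits)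
  qed
  then obtain D where D: "ultra D" and Dall: "\<forall>q\<in>insert None (Some ` p). ae D (\<lambda>x. x \<in> tuples n
      (carrier prod) \<and>
      (case q of None \<Rightarrow> True | Some (\<psi>, as) \<Rightarrow> sat_at prod \<psi> (x @ as)))" by blast
  have Dt: "ae D (\<lambda>x. x \<in> tuples n (carrier prod))" using bspec[OF Dall, of None] by simp
  have Dp: "ae D (\<lambda>x. sat_at prod \<psi> (x @ as))" if "(\<psi>, as) \<in> p" for \<psi> as
    using bspec[OF Dall, of "Some (\<psi>, as)"] that by (simp add: ultra_conj[OF D])
  have "\<exists>h. \<not> half_graph prod \<phi> n w h" if "\<phi> \<in> set \<Phi>" for \<phi>
    using stable \<Phi>[OF that] by (simp add: formulas_def)
  then obtain hf where hf: "\<And>\<phi>. \<phi> \<in> set \<Phi> \<Longrightarrow> \<not> half_graph prod \<phi> n w (hf \<phi>)" by metis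
  obtain h where "\<forall>l\<in>hf ` set \<Phi>. l \<le> h" using finite_nat_set_iff_bounded_le by blast
  hence h: "\<not> half_graph prod \<phi> n w h" if "\<phi> \<in> set \<Phi>" for \<phi>
    using hf[OF that] half_graph_mono that by blast
  \<comment> \<open>The bound of \<open>approximation_of_no_half_graph\<close> with the patterns as
    colours; \<open>Suc h\<close> occurs because \<open>half_graph_of_le\<close> gives up one
    index.\<close>
  define k where "k = Suc (2 * card (set \<Phi>) * Suc h)"
  have approx: "\<exists>xs. (\<forall>i<m. xs i \<in> tuples n (carrier prod)) \<and> (\<forall>\<phi>\<in>set \<Phi>. \<forall>y\<in>tuples w (carrier prod).
      card {i. i < m \<and> sat_at prod \<phi> (xs i @ y) \<noteq> ae D (\<lambda>x. sat_at prod \<phi> (x @ y))} < k)" for m ::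
          nat
  proof -
    have "\<exists>xs. (\<forall>i<m. xs i \<in> tuples n (carrier prod)) \<and> (\<forall>q\<in>set \<Phi> \<times> tuples w (carrier prod).
      card {i. i < m \<and> sat_at prod (fst q) (xs i @ snd q) \<noteq> ae D (\<lambda>x. sat_at prod (fst q) (x @ snd
          q))} <
        Suc (2 * card (set \<Phi>) * Suc h))"
    proof (rule approximation_of_no_half_graph[OF D Dt, where col = fst and
        R = "\<lambda>x q. sat_at prod (fst q) (x @ snd q)"])
      fix b \<phi> xs ys
      assume \<phi>: "\<phi> \<in> set \<Phi>" and t: "\<forall>i<Suc h. xs i \<in> tuples n (carrier prod) \<and>
          ys i \<in> set \<Phi> \<times> tuples w (carrier prod) \<and> fst (ys i) = \<phi>"
        and R: "\<forall>i<Suc h. \<forall>j<Suc h. (sat_at prod (fst (ys j)) (xs i @ snd (ys j)) = b) \<longleftrightarrow> i \<le> j"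
      have "half_graph prod \<phi> n w h"
      proof (rule half_graph_of_le)
        show "\<forall>i<Suc h. xs i \<in> tuples n (carrier prod) \<and> (snd \<circ> ys) i \<in> tuples w (carrier prod)"
          using t by (simp add: mem_Times_iff)
        show "\<forall>i<Suc h. \<forall>j<Suc h. (sat_at prod \<phi> (xs i @ (snd \<circ> ys) j) = b) \<longleftrightarrow> i \<le> j"
          using R t by simp
      qed
      thus False using h[OF \<phi>] by blast
    next
      show "finite (set \<Phi>)" by simp
      show "fst q \<in> set \<Phi>" if "q \<in> set \<Phi> \<times> tuples w (carrier prod)" for q using that by (simp add:
          mem_Times_iff)
    qed
    thus ?thesis by (simp only: k_def ball_simps split_paired_Ball_Sigma fst_conv snd_conv)
  qed
  \<comment> \<open>The approximation of length \<open>2 * k\<close> is fixed as the set of voters,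
    so the relevant part of \<open>D\<close> is coded by finitely many elements of
    \<open>prod\<close>.\<close>
  from approx[of "2 * k"] obtain e where e: "\<forall>b<2 * k. e b \<in> tuples n (carrier prod)"
      "\<forall>\<phi>\<in>set \<Phi>. \<forall>y\<in>tuples w (carrier prod).
      card {i. i < 2 * k \<and> sat_at prod \<phi> (e i @ y) \<noteq> ae D (\<lambda>x. sat_at prod \<phi> (x @ y))} < k"
    by (elim exE conjE)
  note e = e[rule_format]
  have maj: "majority prod \<phi> k e y \<longleftrightarrow> ae D (\<lambda>x. sat_at prod \<phi> (x @ y))"
    if "\<phi> \<in> set \<Phi>" "y \<in> tuples w (carrier prod)" for \<phi> y
    unfolding majority_def by (rule majority_of_few_errors[where P = "\<lambda>b. sat_at prod \<phi> (e b @
        y)"], rule e(2)[OF that])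
  have "\<exists>c. (\<forall>j\<in>K. c j \<in> tuples n (carrier prod)) \<and> (\<forall>\<phi>\<in>set \<Phi>. \<forall>y\<in>tuples w (carrier prod).
      finite {j \<in> K. sat_at prod \<phi> (c j @ y) \<noteq> majority prod \<phi> k e y})"
  proof (rule approximating_sequence)
    show "fm_in L \<phi> \<and> fv \<phi> \<subseteq> {..<n + w}" if "\<phi> \<in> set \<Phi>" for \<phi> by (rule \<Phi>L[OF that])
    show "approximation_condition N \<Phi> n w k \<in> C" by (rule C(1)) (use \<Phi> in \<open>auto simp: formulas_def\<close>)
    show "counterexample_condition N \<phi> n w k m \<in> C" if "\<phi> \<in> set \<Phi>" for \<phi> m
      by (rule C(2)) (use \<Phi>[OF that] in \<open>simp add: formulas_def\<close>)
    show "e b \<in> tuples n (carrier prod)" if "b < 2 * k" for b by (rule e(1)[OF that])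
    show "K \<noteq> {}" using K by auto
    show "\<exists>xs. (\<forall>b<m. xs b \<in> tuples n (carrier prod)) \<and> (\<forall>\<phi>\<in>set \<Phi>. \<forall>y\<in>tuples w (carrier prod).
      card {b. b < m \<and> sat_at prod \<phi> (xs b @ y) \<noteq> majority prod \<phi> k e y} < k)" for m :: nat
      using approx[of m] by (simp add: maj cong: ball_cong)
  qed
  then obtain c where c: "\<forall>j\<in>K. c j \<in> tuples n (carrier prod)" "\<forall>\<phi>\<in>set \<Phi>. \<forall>y\<in>tuples w (carrier
      prod).
      finite {j \<in> K. sat_at prod \<phi> (c j @ y) \<noteq> majority prod \<phi> k e y}" by (elim exE conjE)
  note c = c[rule_format]
  \<comment> \<open>\<open>A\<close> may be empty, but \<open>sat_pattern\<close> needs a filler;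
    one more parameter keeps the set smaller than \<open>K\<close>.\<close>
  obtain a0 where a0: "a0 \<in> carrier prod" using is_struct_prod by (auto simp: is_struct_def)
  let ?A = "insert a0 A"
  have sub: "tuples w ?A \<subseteq> tuples w (carrier prod)" using A(1) a0 by (auto simp: tuples_def)
  have "|set \<Phi> \<times> tuples w ?A| <o |K|"
    by (intro card_of_tuples_ordLess K card_of_insert_ordLess A(2)) simp
  moreover have "finite {j \<in> K. sat_at prod (fst q) (c j @ snd q) \<noteq> majority prod (fst q) k e (snd
      q)}"
    if "q \<in> set \<Phi> \<times> tuples w ?A" for q
    by (rule c(2)) (use that sub in \<open>auto simp: mem_Times_iff\<close>)
  ultimately have "\<exists>j\<in>K. \<forall>q\<in>set \<Phi> \<times> tuples w ?A.
      j \<notin> {j \<in> K. sat_at prod (fst q) (c j @ snd q) \<noteq> majority prod (fst q) k e (snd q)}"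
    by (rule ex_outside_finite_sets[OF K])
  then obtain j where j: "j \<in> K" and good: "\<forall>q\<in>set \<Phi> \<times> tuples w ?A.
      j \<notin> {j \<in> K. sat_at prod (fst q) (c j @ snd q) \<noteq> majority prod (fst q) k e (snd q)}"
    by (elim bexE)
  have agree: "sat_at prod \<phi> (c j @ y) \<longleftrightarrow> ae D (\<lambda>x. sat_at prod \<phi> (x @ y))"
    if "\<phi> \<in> set (patterns n w ds)" "y \<in> tuples w ?A" for \<phi> y
  proof -
    have "(\<phi>, y) \<in> set \<Phi> \<times> tuples w ?A" using that by (simp add: \<Phi>_def)
    from bspec[OF good this] j have "sat_at prod \<phi> (c j @ y) \<longleftrightarrow> majority prod \<phi> k e y" by simp
    also have "\<dots> \<longleftrightarrow> ae D (\<lambda>x. sat_at prod \<phi> (x @ y))"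
      by (rule maj) (use that sub in \<open>auto simp: \<Phi>_def\<close>)
    finally show ?thesis .
  qed
  have len: "ae D (\<lambda>x. length x = n)" by (rule ultra_mono[OF D Dt]) (simp add: tuples_def)
  have "realizes prod n (c j) p"
    unfolding realizes_def
  proof (intro conjI ballI, rule c(1)[OF j], clarify)
    fix \<psi> as assume pa: "(\<psi>, as) \<in> p"
    hence "(\<psi>, as) \<in> instances \<Delta> n A" using p by (auto simp: is_local_type_def)
    then obtain \<theta> \<sigma> where \<theta>: "\<theta> \<in> bool_alg \<Delta>" "\<psi> = rename \<sigma> \<theta>" "set as \<subseteq> A" "\<sigma> ` fv \<theta> \<subseteq> {..<n +
        length as}"
      by (auto simp: instances_def fv_rename)
    have eq: "sat_at prod \<psi> (x @ as) \<longleftrightarrow> sat prod (\<lambda>v. (x @ as) ! \<sigma> v) \<theta>" for x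
      by (simp add: \<theta>(2) sat_at_def sat_rename comp_def)
    have "sat prod (\<lambda>v. (c j @ as) ! \<sigma> v) \<theta> \<longleftrightarrow> ae D (\<lambda>x. sat prod (\<lambda>v. (x @ as) ! \<sigma> v) \<theta>)"
      by (rule sat_instance_iff_ae[where A = ?A and ds = ds and w = w and n = n, OF D len])
        (use c(1)[OF j] w \<theta> agree ds in \<open>auto simp: tuples_def\<close>)
    with Dp[OF pa] show "sat_at prod \<psi> (c j @ as)" by (simp add: eq)
  qed
  thus ?thesis by blast
qed

end

section \<open>Exactness\<close>

text \<open>Maximality holds because every instance is decided: its negation is an instance as well,
  and one of the two holds almost everywhere.\<close>

lemma local_type_of_ultra:
  assumes D: "ultra D" and t: "ae D (\<lambda>x. x \<in> tuples n (carrier M))"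
  shows "is_local_type M \<Delta> n A {(\<psi>, as) \<in> instances \<Delta> n A. ae D (\<lambda>x. sat_at M \<psi> (x @ as))}"
    (is "is_local_type M \<Delta> n A ?p")
  unfolding is_local_type_def
proof (intro conjI allI impI)
  show "?p \<subseteq> instances \<Delta> n A" by auto
  show "consistent_in M n ?p"
    unfolding consistent_in_def
  proof (intro allI impI, elim conjE)
    fix q assume q: "finite q" "q \<subseteq> ?p"
    have "ae D (\<lambda>x. \<forall>r\<in>q. sat_at M (fst r) (x @ snd r))"
      unfolding ultra_ball[OF D q(1)] using q(2) by auto
    with t have "ae D (\<lambda>x. x \<in> tuples n (carrier M) \<and> (\<forall>r\<in>q. sat_at M (fst r) (x @ snd r)))"
      by (simp add: ultra_conj[OF D])
    from ultra_ex[OF D this] show "\<exists>c. realizes M n c q" by (simp add: realizes_def case_prod_beta)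
  qed
  fix q assume "?p \<subseteq> q \<and> q \<subseteq> instances \<Delta> n A \<and> consistent_in M n q"
  hence q: "?p \<subseteq> q" "q \<subseteq> instances \<Delta> n A" "consistent_in M n q" by blast+
  have "(\<psi>, as) \<in> ?p" if in_q: "(\<psi>, as) \<in> q" for \<psi> as
  proof (rule ccontr)
    assume no: "(\<psi>, as) \<notin> ?p"
    have inst: "(\<psi>, as) \<in> instances \<Delta> n A" using in_q q(2) by blast
    then obtain \<theta> \<sigma> where "\<theta> \<in> bool_alg \<Delta>" "\<psi> = rename \<sigma> \<theta>" by (auto simp: instances_def)
    hence "Neg \<theta> \<in> bool_alg \<Delta>" "Neg \<psi> = rename \<sigma> (Neg \<theta>)" by (auto intro: bool_alg.neg)
    hence "\<exists>\<theta>\<in>bool_alg \<Delta>. \<exists>\<sigma>. Neg \<psi> = rename \<sigma> \<theta>" by blast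
    hence "(Neg \<psi>, as) \<in> instances \<Delta> n A" using inst unfolding instances_def by simp
    moreover have "ae D (\<lambda>x. sat_at M (Neg \<psi>) (x @ as))"
      using no inst by (simp add: sat_at_def ultra_not[OF D])
    ultimately have "(Neg \<psi>, as) \<in> q" using q(1) by auto
    with in_q q(3) obtain c where "realizes M n c {(\<psi>, as), (Neg \<psi>, as)}"
      unfolding consistent_in_def by (metis empty_subsetI finite.emptyI finite.insertI
          insert_subset)
    thus False by (auto simp: realizes_def sat_at_def)
  qed
  thus "q = ?p" using q(1) by auto
qed

text \<open>In an infinite model the inequalities with all elements are finitely satisfiable, but a
  realization in the model would have to differ from itself.\<close>

lemma not_locally_saturated:
  fixes L :: "('f, 'r) language" and M :: "('f, 'r, 'u) struct"
  assumes inf: "infinite (carrier M)" and \<mu>: "|carrier M| <o \<mu>"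
  shows "\<not> locally_saturated L M \<mu>"
proof
  assume sat: "locally_saturated L M \<mu>"
  let ?\<delta> = "Eq (Var 0) (Var 1) :: ('f, 'r) fm"
  \<comment> \<open>The ultrafilter lives on lists of length one, the form of realizations when
    \<open>n\<close> is 1.\<close>
  have "\<exists>D. ultra D \<and> (\<forall>a\<in>carrier M. ae D (\<lambda>x. \<exists>b\<in>carrier M. x = [b] \<and> b \<noteq> a))"
  proof (rule ultra_ex_of_fip)
    fix J assume "finite J" "J \<subseteq> carrier M"
    then obtain b where "b \<in> carrier M" "b \<notin> J" using inf by (meson finite_subset subsetI)
    thus "\<exists>x. \<forall>a\<in>J. \<exists>b\<in>carrier M. x = [b] \<and> b \<noteq> a" by (intro exI[of _ "[b]"]) auto
  qed
  then obtain D where D: "ultra D" and ne: "\<And>a. a \<in> carrier M \<Longrightarrow> ae D (\<lambda>x. \<exists>b\<in>carrier M. x = [b] \<and>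
      b \<noteq> a)"
    by blast
  obtain a where "a \<in> carrier M" using inf by fastforce
  hence t: "ae D (\<lambda>x. x \<in> tuples 1 (carrier M))"
    by (intro ultra_mono[OF D ne]) (auto simp: tuples_def)
  let ?p = "{(\<psi>, as) \<in> instances {?\<delta>} 1 (carrier M). ae D (\<lambda>x. sat_at M \<psi> (x @ as))}"
  have "?\<delta> \<in> formulas L" by (simp add: formulas_def)
  then obtain c where c: "realizes M 1 c ?p"
    using sat local_type_of_ultra[OF D t, of "{?\<delta>}" "carrier M"] \<mu> unfolding locally_saturated_def
    by (metis (no_types, lifting) empty_subsetI finite.emptyI finite.insertI insert_subset
        subset_refl)
  then obtain b where b: "c = [b]" "b \<in> carrier M" by (auto simp: realizes_def tuples_def
      length_Suc_conv)
  have "Neg ?\<delta> \<in> bool_alg {?\<delta>}" by (intro bool_alg.neg bool_alg.gen) simp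
  moreover have "Neg ?\<delta> = rename (\<lambda>i. i) (Neg ?\<delta>)" by simp
  ultimately have "\<exists>\<theta>\<in>bool_alg {?\<delta>}. \<exists>\<sigma>. Neg ?\<delta> = rename \<sigma> \<theta>" by blast
  hence "(Neg ?\<delta>, [b]) \<in> instances {?\<delta>} 1 (carrier M)"
    unfolding instances_def using b(2) by simp
  moreover have "ae D (\<lambda>x. sat_at M (Neg ?\<delta>) (x @ [b]))"
    by (rule ultra_mono[OF D ne[OF b(2)]]) (auto simp: sat_at_def)
  ultimately have "(Neg ?\<delta>, [b]) \<in> ?p" by simp
  with c have "sat_at M (Neg ?\<delta>) (c @ [b])" unfolding realizes_def by blast
  thus False by (simp add: sat_at_def b(1))
qed

theorem theorem5p5:
  fixes L :: "('f, 'r) language" and T :: "('f, 'r) fm set" and \<kappa> :: "'k rel"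
  assumes "complete_theory TYPE('u) L T"
    and "\<exists>M\<in>(Mod L T :: ('f, 'r, 'u) struct set). infinite (carrier M)"
    and "stable_theory TYPE('u) L T"
    and "Card_order \<kappa>" and "theory_card L \<le>o \<kappa>"
    and "|Pow (Field \<kappa>)| \<le>o |UNIV :: 'u set|"
  shows "local_PC_exact_saturation TYPE('u) L T \<kappa>"
  unfolding local_PC_exact_saturation_def
proof (intro allI impI, elim conjE)
  fix L1 :: "('f, 'r) language" and T1 :: "('f, 'r) fm set"
  assume L1: "sublanguage L L1" "T \<subseteq> T1" "is_theory TYPE('u) L1 T1" "theory_card L1 =o theory_card
      L"
  define K where "K = Field \<kappa>"
  have K\<kappa>: "|K| =o \<kappa>" unfolding K_def by (rule card_of_Field_ordIso[OF assms(4)])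
  have "|formulas L1| \<le>o \<kappa>"
    using L1(4) assms(5) unfolding theory_card_def by (rule ordIso_ordLeq_trans)
  hence cardL1: "|formulas L1| \<le>o |K|" using K\<kappa> ordIso_symmetric ordLeq_ordIso_trans by blast
  hence K: "infinite K" using infinite_formulas card_of_ordLeq_infinite by blast
  have Ku: "|K| \<le>o |UNIV :: 'u set|"
    using assms(6) card_of_Pow ordLess_imp_ordLeq ordLeq_transitive unfolding K_def by blast
  obtain \<iota> :: "nat \<Rightarrow> 'k" where \<iota>: "inj \<iota>" "range \<iota> \<subseteq> K" using infinite_countable_subset[OF K] by
      blast
  obtain N :: "('f, 'r, 'u) struct" where N1: "N \<in> Mod L1 T1" using L1(3) unfolding is_theory_def
      by blast
  \<comment> \<open>Each condition is given by finitely many formulas and numbers, so there are at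
    most as many as elements of \<open>K\<close>, and the ultraproduct stays small.\<close>
  define C :: "('u list \<Rightarrow> 'k set \<Rightarrow> ('k \<Rightarrow> nat \<Rightarrow> 'u) \<Rightarrow> bool) set" where
    "C = (\<lambda>(\<phi>, n, w). half_graph_condition N \<iota> \<phi> n w) ` (formulas L1 \<times> UNIV) \<union>
      ((\<lambda>(\<Phi>, n, w, k). approximation_condition N \<Phi> n w k) ` (lists (formulas L1) \<times> UNIV) \<union>
       (\<lambda>(\<phi>, n, w, k, m). counterexample_condition N \<phi> n w k m) ` (formulas L1 \<times> UNIV))"
  have nat1: "|UNIV :: nat set| \<le>o |K|" using K by (simp add: infinite_iff_card_of_nat)
  have nat2: "|UNIV :: (nat \<times> nat) set| \<le>o |K|"
    using card_of_Times_ordLeq[OF K nat1 nat1] by (simp only: UNIV_Times_UNIV)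
  have nat3: "|UNIV :: (nat \<times> nat \<times> nat) set| \<le>o |K|"
    using card_of_Times_ordLeq[OF K nat1 nat2] by (simp only: UNIV_Times_UNIV)
  have nat4: "|UNIV :: (nat \<times> nat \<times> nat \<times> nat) set| \<le>o |K|"
    using card_of_Times_ordLeq[OF K nat1 nat3] by (simp only: UNIV_Times_UNIV)
  have "|C| \<le>o |K|"
    unfolding C_def
    by (intro card_of_Un_ordLeq[OF K] ordLeq_transitive[OF card_of_image] card_of_Times_ordLeq[OF K]
        card_of_lists_ordLeq_infinite[OF K] cardL1 nat2 nat3 nat4)
  moreover have "is_struct L1 N" using N1 by (simp add: Mod_def)
  ultimately obtain V :: "(nat \<Rightarrow> 'k set) set set" and H \<pi> where "rich_ultraproduct L1 N V H \<pi> K C"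
    using ex_rich_ultraproduct[of L1 N K C] K cardL1 Ku by blast
  then interpret rich_ultraproduct L1 N V H \<pi> K C .
  have L_L1: "\<phi> \<in> formulas L1" if "\<phi> \<in> formulas L" for \<phi>
    using that fm_in_mono[OF L1(1)] by (simp add: formulas_def)
  have half: "half_graph_condition N \<iota> \<phi> n w \<in> C" if "\<phi> \<in> formulas L" for \<phi> n w
    unfolding C_def by (rule UnI1, rule image_eqI[of _ _ "(\<phi>, n, w)"]) (use L_L1[OF that] in
        simp_all)
  have approx: "approximation_condition N \<Phi> n w k \<in> C" if "set \<Phi> \<subseteq> formulas L" for \<Phi> n w k
    unfolding C_def
    by (rule UnI2, rule UnI1, rule image_eqI[of _ _ "(\<Phi>, n, w, k)"]) (use L_L1 that in auto)
  have counter: "counterexample_condition N \<phi> n w k m \<in> C" if "\<phi> \<in> formulas L" for \<phi> n w k m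
    unfolding C_def
    by (rule UnI2, rule UnI2, rule image_eqI[of _ _ "(\<phi>, n, w, k, m)"]) (use L_L1[OF that] in
        simp_all)
  have prod1: "prod \<in> Mod L1 T1" using prod_Mod[OF N1] L1(3) unfolding is_theory_def by blast
  hence prod: "prod \<in> Mod L T"
    using L1(1,2) unfolding Mod_def is_struct_def sublanguage_def by blast
  \<comment> \<open>Stability excludes infinite half graphs in \<open>prod\<close>. The bound on
    finite ones passes through \<open>N\<close>: half graphs of all lengths in \<open>N\<close>
    would produce an infinite one in \<open>prod\<close>, and each finite half graph of
    \<open>prod\<close> descends to \<open>N\<close>.\<close>
  have stable: "\<exists>h. \<not> half_graph prod \<phi> n w h" if \<phi>: "\<phi> \<in> formulas L" "fv \<phi> \<subseteq> {..<n + w}" for \<phi> n w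
  proof -
    have \<phi>1: "fm_in L1 \<phi>" using L_L1[OF \<phi>(1)] by (simp add: formulas_def)
    have "\<not> order_property_in prod \<phi> n w" using assms(3) prod \<phi> unfolding stable_theory_def by blast
    hence "\<exists>h. \<not> half_graph N \<phi> n w h"
      using order_property_prod[OF \<phi>1 \<phi>(2) half[OF \<phi>(1)] \<iota>] by blast
    thus ?thesis using half_graph_prodD[OF \<phi>1 \<phi>(2)] by blast
  qed
  have "locally_saturated L prod \<kappa>"
    unfolding locally_saturated_def
  proof (intro allI impI, elim conjE)
    fix \<Delta> n A p assume *: "finite \<Delta>" "\<Delta> \<subseteq> formulas L" "A \<subseteq> carrier prod" "|A| <o \<kappa>" "is_local_type
        prod \<Delta> n A p"
    have "|A| <o |K|" using *(4) K\<kappa> ordIso_symmetric ordLess_ordIso_trans by blast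
    from prod_realizes_local_type[OF K L1(1) stable approx counter *(1,2,3) this *(5)]
    show "\<exists>c. realizes prod n c p" .
  qed
  moreover have "\<not> locally_saturated L prod (cardSuc \<kappa>)"
  proof (rule not_locally_saturated)
    show "infinite (carrier prod)" using infinite_models[OF assms(1) _ _ prod] assms(2) by blast
    have "carrier prod = \<pi> ` H" by (simp add: prod_def)
    hence "|carrier prod| \<le>o |K|" using ordLeq_transitive[OF card_of_image card_H] by simp
    hence "|carrier prod| \<le>o \<kappa>" using K\<kappa> ordLeq_ordIso_trans by blast
    thus "|carrier prod| <o cardSuc \<kappa>"
      using cardSuc_ordLeq_ordLess[OF assms(4) card_of_Card_order] by blast
  qed
  \<comment> \<open>A structure for \<open>L1\<close> is its own reduct to \<open>L\<close>, so
    \<open>prod\<close> serves as its own expansion.\<close>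
  moreover have "prod \<in> PC L1 T1 L T"
    unfolding PC_def using prod prod1 by (auto simp: is_expansion_def)
  ultimately show "local_exact_saturation L (PC L1 T1 L T :: ('f, 'r, 'u) struct set) \<kappa>"
    unfolding local_exact_saturation_def by blast
qed

end
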